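(* There exist absolute constants $0<c<C$ such that for every $p=p(n)$ with $n^{-0.99}\le p\le 1-n^{-1}$, with probability tending to $1$ as $n\to\infty$ the minimum dimension $d$ such that $G=G(n,p)$ is a graph of touching spheres in $\mathbb{R}^d$ satisfies $$c\,\frac{n\log(1/(1-p))}{\log n}\le d\le C\,\frac{n\log(1/(1-p))}{\log n}.$$
   Context: A graph $G$ on $[n]$ is a graph of touching spheres in $\mathbb{R}^d$ if there are centers $u_1,\dots,u_n\in\mathbb{R}^d$ and radii $r_1,\dots,r_n>0$ (the sphere $S_i$ having center $u_i$ and radius $r_i$) such that for every pair of adjacent vertices $i,j$ the spheres $S_i,S_j$ touch externally, i.e. $\|u_i-u_j\|_2=r_i+r_j$ (no condition on nonadjacent pairs). $G(n,p)$ denotes the binomial random graph on $[n]$ in which each pair is an edge independently with probability $p$. *)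

theory Defs
  imports "HOL-Probability.Probability"
begin

text \<open>Graphs on the vertex set [n] = {1..n} are represented by their edge sets,
  i.e. sets of 2-element subsets of {1..n}.\<close>

definition all_pairs :: "nat \<Rightarrow> nat set set" where
  "all_pairs n = {{i, j} | i j. i \<in> {1..n} \<and> j \<in> {1..n} \<and> i \<noteq> j}"

definition gnp :: "nat \<Rightarrow> real \<Rightarrow> nat set set pmf" where
  "gnp n p = map_pmf (\<lambda>f. {e. f e}) (Pi_pmf (all_pairs n) False (\<lambda>_. bernoulli_pmf p))"

definition dist_d :: "nat \<Rightarrow> (nat \<Rightarrow> real) \<Rightarrow> (nat \<Rightarrow> real) \<Rightarrow> real" where
  "dist_d d x y = sqrt (\<Sum>k<d. (x k - y k)^2)"

definition touching_spheres :: "nat \<Rightarrow> nat set set \<Rightarrow> nat \<Rightarrow> bool" where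
  "touching_spheres n E d \<longleftrightarrow>
     (\<exists>(u :: nat \<Rightarrow> nat \<Rightarrow> real) (r :: nat \<Rightarrow> real).
        (\<forall>i\<in>{1..n}. r i > 0) \<and>
        (\<forall>i\<in>{1..n}. \<forall>j\<in>{1..n}. {i, j} \<in> E \<longrightarrow> dist_d d (u i) (u j) = r i + r j))"

definition sphere_dim :: "nat \<Rightarrow> nat set set \<Rightarrow> nat" where
  "sphere_dim n E = (LEAST d. touching_spheres n E d)"

end

theory Submission
  imports Defs "HOL-Real_Asymp.Real_Asymp" "Jordan_Normal_Form.Determinant"
begin

text \<open>Upper bound: a proper colouring with \<open>k\<close> colours puts the vertices on the points \<open>e\<^sub>c / sqrt 2\<close>,
  so the dimension is at most the chromatic number. Exposing the vertices one at a time, a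
  \<open>k\<close>-colouring fails to extend with probability at most \<open>exp (- k (1 - p)\<^bsup>n/k\<^esup>)\<close>.

  Lower bound: spheres in dimension \<open>d\<close> give a symmetric matrix of rank at most \<open>d + 3\<close> with
  nonzero diagonal that vanishes on all edges, so the question becomes one about the minimum rank
  of random graphs. Among all principal submatrices take one minimising the ratio \<open>\<rho>\<close> of rank to
  size; if it has \<open>s\<close> nonzero entries, then some row basis has at most \<open>\<rho> s\<close> of them. The
  support of the submatrix is a zero pattern of polynomials in the entries of this basis, so there
  are only \<open>n\<^bsup>O(\<rho> s)\<^esup>\<close> supports, each of which avoids \<open>G(n,p)\<close> with probability at most
  \<open>(1 - p)\<^bsup>s/4\<^esup>\<close>.\<close>

section \<open>Sparse row bases of symmetric matrices\<close>

text \<open>Gaussian elimination, one unknown per equation. The index types are left arbitrary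
  because it serves both the exchange argument for rows and the relation between products of
  polynomials.\<close>

lemma homogeneous_system_nontrivial:
  fixes \<alpha> :: "'a \<Rightarrow> 'b \<Rightarrow> 'f :: field"
  assumes "finite K" "finite I" "card K < card I"
  shows "\<exists>z. (\<exists>a\<in>I. z a \<noteq> 0) \<and> (\<forall>k\<in>K. (\<Sum>a\<in>I. z a * \<alpha> a k) = 0)"
  using assms
proof (induction K arbitrary: I \<alpha> rule: finite_induct)
  case empty
  then obtain a where "a \<in> I" by fastforce
  then show ?case by (intro exI[of _ "\<lambda>_. 1"]) auto
next
  case (insert k K)
  show ?case
  proof (cases "\<forall>a\<in>I. \<alpha> a k = 0")
    case True
    with insert.IH[of I \<alpha>] insert.prems insert.hyps show ?thesis
      by auto
  next
    case False
    then obtain a0 where a0: "a0 \<in> I" "\<alpha> a0 k \<noteq> 0" by blast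
    define t where "t a = \<alpha> a k / \<alpha> a0 k" for a
    have "card K < card (I - {a0})" using insert a0 by auto
    with insert.IH[of "I - {a0}" "\<lambda>a l. \<alpha> a l - t a * \<alpha> a0 l"] insert.prems
    obtain z where z: "\<exists>a\<in>I-{a0}. z a \<noteq> 0"
      "\<And>l. l \<in> K \<Longrightarrow> (\<Sum>a\<in>I-{a0}. z a * (\<alpha> a l - t a * \<alpha> a0 l)) = 0" by auto
    \<comment> \<open>The pivot unknown gets the value that solves equation \<open>k\<close>;
      substituting it into any other equation \<open>l\<close> leaves the reduced coefficient
      \<open>\<alpha> a l - t a * \<alpha> a0 l\<close>.\<close>
    define s where "s = - (\<Sum>a\<in>I-{a0}. z a * t a)"
    have eq: "(\<Sum>a\<in>I. (z(a0 := s)) a * \<alpha> a l) = (\<Sum>a\<in>I-{a0}. z a * (\<alpha> a l - t a * \<alpha> a0 l))" for l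
    proof -
      have "(\<Sum>a\<in>I. (z(a0 := s)) a * \<alpha> a l) = s * \<alpha> a0 l + (\<Sum>a\<in>I-{a0}. (z(a0 := s)) a * \<alpha> a l)"
        using a0 insert.prems by (subst sum.remove[of _ a0]) auto
      also have "(\<Sum>a\<in>I-{a0}. (z(a0 := s)) a * \<alpha> a l) = (\<Sum>a\<in>I-{a0}. z a * \<alpha> a l)"
        by (intro sum.cong) auto
      finally show ?thesis
        by (simp add: s_def right_diff_distrib sum_subtractf sum_distrib_right mult.assoc)
    qed
    have "(\<Sum>a\<in>I. (z(a0 := s)) a * \<alpha> a l) = 0" if "l \<in> insert k K" for l
    proof (cases "l = k")
      case True
      then show ?thesis unfolding eq using a0 by (simp add: t_def)
    next
      case False
      with that z(2) show ?thesis unfolding eq by auto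
    qed
    moreover have "\<exists>a\<in>I. (z(a0 := s)) a \<noteq> 0" using z(1) by auto
    ultimately show ?thesis by blast
  qed
qed

text \<open>Rows are functions looked at on a column set \<open>V\<close>, so passing to a submatrix
  only changes \<open>V\<close> and needs no reindexing.\<close>

definition row_indep :: "(nat \<Rightarrow> nat \<Rightarrow> real) \<Rightarrow> nat set \<Rightarrow> nat set \<Rightarrow> bool" where
  "row_indep M V I \<longleftrightarrow> (\<forall>z. (\<forall>l\<in>V. (\<Sum>a\<in>I. z a * M a l) = 0) \<longrightarrow> (\<forall>a\<in>I. z a = 0))"

definition in_row_span :: "(nat \<Rightarrow> nat \<Rightarrow> real) \<Rightarrow> nat set \<Rightarrow> nat set \<Rightarrow> nat \<Rightarrow> bool" where
  "in_row_span M V I j \<longleftrightarrow> (\<exists>c. \<forall>l\<in>V. M j l = (\<Sum>a\<in>I. c a * M a l))"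

definition supp :: "(nat \<Rightarrow> nat \<Rightarrow> real) \<Rightarrow> nat set \<Rightarrow> nat set \<Rightarrow> (nat \<times> nat) set" where
  "supp M A B = {(a, b). a \<in> A \<and> b \<in> B \<and> M a b \<noteq> 0}"

lemma row_indepD:
  "row_indep M V I \<Longrightarrow> (\<And>l. l \<in> V \<Longrightarrow> (\<Sum>a\<in>I. z a * M a l) = 0) \<Longrightarrow> a \<in> I \<Longrightarrow> z a = 0"
  unfolding row_indep_def by blast

lemma in_row_span_mono:
  "in_row_span M V I j \<Longrightarrow> V' \<subseteq> V \<Longrightarrow> in_row_span M V' I j"
  unfolding in_row_span_def by (meson subsetD)

lemma in_row_span_self:
  assumes "finite I" "j \<in> I"
  shows "in_row_span M V I j"
  unfolding in_row_span_def
proof (intro exI ballI)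
  fix l
  show "M j l = (\<Sum>a\<in>I. of_bool (a = j) * M a l)"
    using assms by (simp add: of_bool_def if_distrib[of "\<lambda>x. x * _"] cong: if_cong)
qed

lemma row_indep_insert:
  assumes "finite I" "row_indep M V I" "\<not> in_row_span M V I j"
  shows "row_indep M V (insert j I)"
  unfolding row_indep_def
proof (intro allI impI)
  fix z assume z: "\<forall>l\<in>V. (\<Sum>a\<in>insert j I. z a * M a l) = 0"
  have "j \<notin> I" using assms in_row_span_self by blast
  with z assms(1) have eq: "z j * M j l + (\<Sum>a\<in>I. z a * M a l) = 0" if "l \<in> V" for l
    using that by simp
  have "z j = 0"
  proof (rule ccontr)
    assume nz: "z j \<noteq> 0"
    have "M j l = (\<Sum>a\<in>I. (- z a / z j) * M a l)" if "l \<in> V" for l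
    proof -
      have "M j l = - (\<Sum>a\<in>I. z a * M a l) / z j"
        using eq[OF that] nz by (simp add: field_simps)
      also have "\<dots> = (\<Sum>a\<in>I. (- z a / z j) * M a l)"
        by (simp add: sum_divide_distrib sum_negf)
      finally show ?thesis .
    qed
    then have "in_row_span M V I j"
      unfolding in_row_span_def by (intro exI[of _ "\<lambda>a. - z a / z j"] ballI)
    with assms(3) show False by simp
  qed
  moreover have "\<forall>a\<in>I. z a = 0"
    using assms(2) eq \<open>z j = 0\<close> unfolding row_indep_def by auto
  ultimately show "\<forall>a\<in>insert j I. z a = 0" by auto
qed

lemma row_basis_extend:
  assumes "finite T" "I0 \<subseteq> T" "row_indep M V I0"
  shows "\<exists>I. I0 \<subseteq> I \<and> I \<subseteq> T \<and> row_indep M V I \<and> (\<forall>j\<in>T. in_row_span M V I j)"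
proof -
  let ?P = "{I. I0 \<subseteq> I \<and> I \<subseteq> T \<and> row_indep M V I}"
  have "finite ?P" using assms(1) by (auto intro: finite_subset[of _ "Pow T"])
  moreover have "I0 \<in> ?P" using assms by auto
  ultimately have "\<exists>I\<in>?P. \<forall>I'\<in>?P. I \<subseteq> I' \<longrightarrow> I = I'"
    by (intro finite_has_maximal) auto
  then obtain I where I: "I \<in> ?P" and mx: "\<forall>I'\<in>?P. I \<subseteq> I' \<longrightarrow> I = I'"
    by (elim bexE)
  have "finite I" using I assms(1) finite_subset by blast
  have "in_row_span M V I j" if "j \<in> T" for j
  proof (rule ccontr)
    assume n: "\<not> in_row_span M V I j"
    then have "insert j I \<in> ?P" using I row_indep_insert[OF \<open>finite I\<close>] that by auto
    with mx have "j \<in> I" by blast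
    with n in_row_span_self \<open>finite I\<close> show False by blast
  qed
  with I show ?thesis by blast
qed

text \<open>The generators \<open>g\<close> need not be rows of \<open>M\<close>: besides comparing
  two row families, this bounds the rank by the number of coordinate functions describing a sphere
  configuration.\<close>

lemma row_indep_card_le:
  assumes "finite I" "finite K" "row_indep M V I"
    and gen: "\<And>a. a \<in> I \<Longrightarrow> \<exists>c. \<forall>l\<in>V. M a l = (\<Sum>k\<in>K. c k * g k l)"
  shows "card I \<le> card K"
proof (rule ccontr)
  assume "\<not> card I \<le> card K"
  then have less: "card K < card I" by simp
  obtain c where c: "\<And>a l. a \<in> I \<Longrightarrow> l \<in> V \<Longrightarrow> M a l = (\<Sum>k\<in>K. c a k * g k l)"
    using gen by metis
  obtain z where z: "\<exists>a\<in>I. z a \<noteq> 0" "\<And>k. k \<in> K \<Longrightarrow> (\<Sum>a\<in>I. z a * c a k) = 0"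
    using homogeneous_system_nontrivial[OF assms(2,1) less, of c] by blast
  have "(\<Sum>a\<in>I. z a * M a l) = 0" if "l \<in> V" for l
  proof -
    have "(\<Sum>a\<in>I. z a * M a l) = (\<Sum>a\<in>I. \<Sum>k\<in>K. z a * c a k * g k l)"
      using c that by (simp add: sum_distrib_left mult.assoc)
    also have "\<dots> = (\<Sum>k\<in>K. (\<Sum>a\<in>I. z a * c a k) * g k l)"
      by (subst sum.swap) (simp add: sum_distrib_right)
    finally show ?thesis using z(2) by simp
  qed
  then show False using z(1) assms(3) row_indepD by blast
qed

section \<open>Row weights and bases of minimal rank ratio\<close>

lemma supp_card:
  assumes "finite A" "finite B"
  shows "card (supp M A B) = (\<Sum>a\<in>A. card {b\<in>B. M a b \<noteq> 0})"
proof -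
  have "supp M A B = (SIGMA a:A. {b\<in>B. M a b \<noteq> 0})" unfolding supp_def by auto
  then show ?thesis using assms by simp
qed

lemma sum_layer_cake:
  fixes w :: "'a \<Rightarrow> nat"
  assumes "finite A" "\<And>a. a \<in> A \<Longrightarrow> w a \<le> m"
  shows "(\<Sum>a\<in>A. w a) = (\<Sum>h\<in>{1..m}. card {a\<in>A. h \<le> w a})"
proof -
  have "(\<Sum>a\<in>A. w a) = (\<Sum>a\<in>A. card {h\<in>{1..m}. h \<le> w a})"
  proof (intro sum.cong refl)
    fix a assume "a \<in> A"
    then have "{h\<in>{1..m}. h \<le> w a} = {1..w a}" using assms(2) by force
    then show "w a = card {h\<in>{1..m}. h \<le> w a}" by simp
  qed
  also have "\<dots> = (\<Sum>a\<in>A. \<Sum>h\<in>{1..m}. of_bool (h \<le> w a))"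
    by (intro sum.cong refl) (simp add: Int_def)
  also have "\<dots> = (\<Sum>h\<in>{1..m}. \<Sum>a\<in>A. of_bool (h \<le> w a))" by (rule sum.swap)
  also have "\<dots> = (\<Sum>h\<in>{1..m}. card {a\<in>A. h \<le> w a})"
    using assms(1) by (intro sum.cong refl) (simp add: Int_def)
  finally show ?thesis .
qed

text \<open>A greedy basis: rows enter in order of weight, so at every threshold \<open>h'\<close>
  the chosen rows lighter than \<open>h'\<close> already span all rows lighter than
  \<open>h'\<close>. Going from \<open>h\<close> to \<open>Suc h\<close> only extends the set, so
  the earlier thresholds survive.\<close>

lemma filtered_row_basis:
  fixes w :: "nat \<Rightarrow> nat"
  assumes "finite U"
  shows "\<exists>I. I \<subseteq> {a\<in>U. w a < h} \<and> row_indep M V I \<and>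
           (\<forall>h'\<le>h. \<forall>j\<in>{a\<in>U. w a < h'}. in_row_span M V (I \<inter> {a\<in>U. w a < h'}) j)"
proof (induction h)
  case 0
  then show ?case by (auto simp: row_indep_def)
next
  case (Suc h)
  then obtain I where I: "I \<subseteq> {a\<in>U. w a < h}" "row_indep M V I"
    "\<And>h' j. h' \<le> h \<Longrightarrow> j \<in> {a\<in>U. w a < h'} \<Longrightarrow> in_row_span M V (I \<inter> {a\<in>U. w a < h'}) j"
    by blast
  have "I \<subseteq> {a\<in>U. w a < Suc h}" using I(1) by auto
  from row_basis_extend[OF _ this I(2)] assms obtain J where
    J: "I \<subseteq> J" "J \<subseteq> {a\<in>U. w a < Suc h}" "row_indep M V J"
       "\<And>j. j \<in> {a\<in>U. w a < Suc h} \<Longrightarrow> in_row_span M V J j" by auto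
  have fin: "finite J" using J(2) assms by (auto intro: finite_subset)
  have "in_row_span M V (J \<inter> {a\<in>U. w a < h'}) j"
    if h': "h' \<le> Suc h" and j: "j \<in> {a\<in>U. w a < h'}" for h' j
  proof (cases "h' = Suc h")
    case True
    then have "J \<inter> {a\<in>U. w a < h'} = J" using J(2) by auto
    then show ?thesis using J(4) j True by auto
  next
    case False
    then have "in_row_span M V (I \<inter> {a\<in>U. w a < h'}) j" using I(3) h' j by auto
    then obtain c where c: "\<And>l. l \<in> V \<Longrightarrow> M j l = (\<Sum>a\<in>I \<inter> {a\<in>U. w a < h'}. c a * M a l)"
      unfolding in_row_span_def by blast
    \<comment> \<open>Light rows that \<open>J\<close> might have in addition to \<open>I\<close>
      receive coefficient 0.\<close>
    let ?c = "\<lambda>a. if a \<in> I then c a else 0"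
    have "M j l = (\<Sum>a\<in>J \<inter> {a\<in>U. w a < h'}. ?c a * M a l)" if "l \<in> V" for l
      unfolding c[OF that] using fin J(1)
      by (intro sum.mono_neutral_cong_left) auto
    then show ?thesis unfolding in_row_span_def by (intro exI[of _ ?c]) blast
  qed
  with J show ?case by blast
qed

lemma row_indep_empty: "row_indep M V {}"
  unfolding row_indep_def by simp

text \<open>Minimality of the rank ratio of \<open>U\<close> is used twice. Applied to the rows of weight below \<open>h\<close> it
  forces a basis chosen greedily by weight to contain many light rows. Applied to \<open>U\<close> without the
  support of row \<open>a\<close>, whose rank is smaller by one since \<open>M a a \<noteq> 0\<close>, it shows that every row
  has at least \<open>card U / card I\<close> nonzero entries.\<close>

lemma sparse_row_basis:
  fixes M :: "nat \<Rightarrow> nat \<Rightarrow> real" and g :: "'k \<Rightarrow> nat \<Rightarrow> real"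
  assumes W: "finite W" "W \<noteq> {}" and K: "finite K"
    and sym: "\<And>i j. i \<in> W \<Longrightarrow> j \<in> W \<Longrightarrow> M i j = M j i"
    and diag: "\<And>i. i \<in> W \<Longrightarrow> M i i \<noteq> 0"
    and gen: "\<And>i. i \<in> W \<Longrightarrow> \<exists>c. \<forall>l\<in>W. M i l = (\<Sum>k\<in>K. c k * g k l)"
  shows "\<exists>U I. U \<subseteq> W \<and> U \<noteq> {} \<and> I \<subseteq> U \<and> row_indep M U I \<and> (\<forall>j\<in>U. in_row_span M U I j) \<and>
           card I * card W \<le> card K * card U \<and>
           card (supp M I U) * card U \<le> card I * card (supp M U U) \<and>
           card U * card U \<le> card I * card (supp M U U)"
proof -
  \<comment> \<open>The second component only has to span. Minimality of the ratio makes it as small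
    as possible, and any spanning subset of another submatrix can then be used for
    comparison.\<close>
  define P where "P = {(U, I). U \<subseteq> W \<and> U \<noteq> {} \<and> I \<subseteq> U \<and> (\<forall>j\<in>U. in_row_span M U I j)}"
  define \<rho> where "\<rho> = (\<lambda>(U, I). real (card (I :: nat set)) / real (card (U :: nat set)))"
  have finW: "finite U" if "U \<subseteq> W" for U using W(1) that finite_subset by blast
  have finP: "finite P"
    by (rule finite_subset[of _ "Pow W \<times> Pow W"]) (auto simp: P_def W)
  obtain IW where IW: "IW \<subseteq> W" "row_indep M W IW" "\<And>j. j \<in> W \<Longrightarrow> in_row_span M W IW j"
    using row_basis_extend[OF W(1) empty_subsetI row_indep_empty, of M W] by blast
  have IWK: "card IW \<le> card K"
    by (rule row_indep_card_le[OF finW[OF IW(1)] K IW(2), of g]) (use gen IW(1) in blast)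
  have WP: "(W, IW) \<in> P" using IW W by (auto simp: P_def)
  obtain UI where UI: "is_arg_min \<rho> (\<lambda>x. x \<in> P) UI"
    using ex_is_arg_min_if_finite[OF finP] WP by blast
  obtain U I where [simp]: "UI = (U, I)" by (cases UI)
  have UIP: "(U, I) \<in> P" and min: "\<And>U' I'. (U', I') \<in> P \<Longrightarrow> \<rho> (U, I) \<le> \<rho> (U', I')"
    using UI by (auto simp: is_arg_min_linorder)
  have U: "U \<subseteq> W" "U \<noteq> {}" "I \<subseteq> U" "\<And>j. j \<in> U \<Longrightarrow> in_row_span M U I j"
    using UIP by (auto simp: P_def)
  note fU = finW[OF U(1)]
  have fI: "finite I" using U(3) fU finite_subset by blast
  have cU: "card U > 0" using U(2) fU by (simp add: card_gt_0_iff)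
  \<comment> \<open>Minimality with denominators cleared, which also covers empty
    \<open>U'\<close>.\<close>
  have cross: "card I * card U' \<le> card I' * card U"
    if "U' \<subseteq> W" "I' \<subseteq> U'" "\<And>j. j \<in> U' \<Longrightarrow> in_row_span M U' I' j" for U' I'
  proof (cases "U' = {}")
    case False
    with that have "(U', I') \<in> P" by (auto simp: P_def)
    from min[OF this] have "real (card I) / card U \<le> real (card I') / card U'"
      by (simp add: \<rho>_def)
    moreover have "card U' > 0" using False finW[OF that(1)] by (simp add: card_gt_0_iff)
    ultimately have "real (card I) * card U' \<le> real (card I') * card U"
      using cU by (simp add: field_simps)
    then show ?thesis by (metis of_nat_le_iff of_nat_mult)
  qed simp
  define w where "w a = card {b\<in>U. M a b \<noteq> 0}" for a
  define m where "m = card U"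
  have wm: "w a \<le> m" for a unfolding w_def m_def by (intro card_mono fU) auto
  \<comment> \<open>No weight exceeds \<open>m\<close>, so the threshold \<open>Suc m\<close> admits
    every row of \<open>U\<close>.\<close>
  obtain J where J: "J \<subseteq> {a\<in>U. w a < Suc m}" "row_indep M U J"
    "\<And>h j. h \<le> Suc m \<Longrightarrow> j \<in> {a\<in>U. w a < h} \<Longrightarrow> in_row_span M U (J \<inter> {a\<in>U. w a < h}) j"
    using filtered_row_basis[OF fU, of w "Suc m" M U] by blast
  have UT: "{a\<in>U. w a < Suc m} = U" using wm by (auto simp: less_Suc_eq_le)
  have JU: "J \<subseteq> U" using J(1) by auto
  have fJ: "finite J" using JU fU finite_subset by blast
  have Jspan: "in_row_span M U J j" if "j \<in> U" for j
    using J(3)[of "Suc m" j] that JU unfolding UT by (simp add: Int_absorb2)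
  have basis_le: "card B \<le> card I" if B: "B \<subseteq> U" "row_indep M U B" for B
  proof (rule row_indep_card_le[OF _ fI B(2), of M])
    show "finite B" using B fU finite_subset by blast
    show "\<exists>c. \<forall>l\<in>U. M a l = (\<Sum>k\<in>I. c k * M k l)" if "a \<in> B" for a
      using U(4)[of a] that B(1) unfolding in_row_span_def by blast
  qed
  have JI: "card J = card I"
  proof (rule antisym)
    show "card J \<le> card I" by (rule basis_le[OF JU J(2)])
    from cross[OF U(1) JU Jspan] show "card I \<le> card J" using cU by simp
  qed
  have "card (supp M J U) * m = (\<Sum>a\<in>J. w a) * m"
    using supp_card[OF fJ fU] by (simp add: w_def)
  \<comment> \<open>The weight sum is cut into levels; it suffices to show for each \<open>h\<close>
    that \<open>J\<close> holds at most its proportional share of the rows of weight at least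
    \<open>h\<close>.\<close>
  also have "(\<Sum>a\<in>J. w a) = (\<Sum>h\<in>{1..m}. card {a\<in>J. h \<le> w a})"
    by (rule sum_layer_cake[OF fJ wm])
  also have "(\<Sum>h\<in>{1..m}. card {a\<in>J. h \<le> w a}) * m \<le> (\<Sum>h\<in>{1..m}. card J * card {a\<in>U. h \<le> w a})"
    unfolding sum_distrib_right
  proof (intro sum_mono)
    fix h assume h: "h \<in> {1..m}"
    let ?L = "{a\<in>U. w a < h}"
    have split: "card X = card (X \<inter> ?L) + card {a\<in>X. h \<le> w a}" if "X \<subseteq> U" for X
    proof -
      have "X = (X \<inter> ?L) \<union> {a\<in>X. h \<le> w a}" using that by auto
      moreover have "(X \<inter> ?L) \<inter> {a\<in>X. h \<le> w a} = {}" by auto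
      moreover have "finite X" using that fU finite_subset by blast
      ultimately show ?thesis by (metis card_Un_disjoint finite_Un)
    qed
    \<comment> \<open>The light rows of \<open>J\<close> span the light rows in all columns of
      \<open>U\<close>, hence in the columns \<open>?L\<close>. By minimality they are at least a
      proportional share of \<open>?L\<close>; passing to complements bounds the heavy rows of
      \<open>J\<close> from above.\<close>
    have "card I * card ?L \<le> card (J \<inter> ?L) * card U"
    proof (rule cross)
      show "?L \<subseteq> W" using U(1) by auto
      show "in_row_span M ?L (J \<inter> ?L) j" if "j \<in> ?L" for j
        by (rule in_row_span_mono[OF J(3)[OF _ that]]) (use h in auto)
    qed auto
    then have "card J * card ?L \<le> card (J \<inter> ?L) * m" unfolding JI m_def .
    moreover have "card J * m = card J * card ?L + card J * card {a\<in>U. h \<le> w a}"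
      using split[of U] by (simp add: m_def Int_def algebra_simps)
    moreover have "card J * m = card (J \<inter> ?L) * m + card {a\<in>J. h \<le> w a} * m"
      using split[OF JU] by (metis add_mult_distrib)
    ultimately show "card {a\<in>J. h \<le> w a} * m \<le> card J * card {a\<in>U. h \<le> w a}" by linarith
  qed
  also have "\<dots> = card J * (\<Sum>a\<in>U. w a)"
    unfolding sum_layer_cake[OF fU wm] by (simp add: sum_distrib_left)
  also have "(\<Sum>a\<in>U. w a) = card (supp M U U)"
    using supp_card[OF fU fU] by (simp add: w_def)
  finally have sparse: "card (supp M J U) * card U \<le> card J * card (supp M U U)"
    by (simp add: m_def)
  have row: "card U \<le> card I * w a" if a: "a \<in> U" for a
  proof -
    let ?U' = "U - {b\<in>U. M a b \<noteq> 0}"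
    have fU': "finite ?U'" using fU by auto
    obtain B where B: "B \<subseteq> ?U'" "row_indep M ?U' B" "\<And>j. j \<in> ?U' \<Longrightarrow> in_row_span M ?U' B j"
      using row_basis_extend[OF fU' empty_subsetI row_indep_empty, of M ?U'] by blast
    have fB: "finite B" using B(1) fU' finite_subset by blast
    have aB: "a \<notin> B" using B(1) a diag U(1) by auto
    have "row_indep M U (insert a B)"
      unfolding row_indep_def
    proof (intro allI impI)
      fix z assume z: "\<forall>l\<in>U. (\<Sum>b\<in>insert a B. z b * M b l) = 0"
      \<comment> \<open>Column \<open>a\<close> isolates \<open>z a\<close>: by symmetry the rows in
        \<open>B\<close> vanish there, while \<open>M a a\<close> does not.\<close>
      have "M b a = 0" if "b \<in> B" for b
      proof -
        have "b \<in> ?U'" using that B(1) by (rule subsetD[rotated])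
        then show ?thesis using a U(1) sym[of b a] by auto
      qed
      then have "(\<Sum>b\<in>B. z b * M b a) = 0" by (intro sum.neutral) auto
      moreover have "z a * M a a + (\<Sum>b\<in>B. z b * M b a) = 0" using z a aB fB by simp
      ultimately have "z a * M a a = 0" by simp
      then have za: "z a = 0" using diag a U(1) by auto
      have "(\<Sum>b\<in>B. z b * M b l) = 0" if "l \<in> ?U'" for l
        using z that aB fB za by auto
      then show "\<forall>b\<in>insert a B. z b = 0" using row_indepD[OF B(2)] za by auto
    qed
    then have "Suc (card B) \<le> card I"
      using basis_le[of "insert a B"] a B(1) aB fB by auto
    then have "Suc (card B) * card U \<le> card I * card U" by (rule mult_le_mono1)
    moreover have "card I * card ?U' \<le> card B * card U"
      by (rule cross) (use U(1) B in auto)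
    moreover have "card U = card ?U' + w a"
      unfolding w_def using fU
      by (metis (no_types, lifting) card_Diff_subset card_mono finite_subset le_add_diff_inverse2 mem_Collect_eq subsetI)
    then have "card I * card U = card I * card ?U' + card I * w a"
      by (metis add_mult_distrib2)
    ultimately show ?thesis by simp
  qed
  have "card U * card U = (\<Sum>a\<in>U. card U)" by simp
  also have "\<dots> \<le> (\<Sum>a\<in>U. card I * w a)" by (intro sum_mono row)
  also have "\<dots> = card I * card (supp M U U)"
    using supp_card[OF fU fU] by (simp add: w_def sum_distrib_left)
  finally have dense: "card U * card U \<le> card I * card (supp M U U)" .
  have "card I * card W \<le> card IW * card U" by (rule cross) (use IW in auto)
  also have "\<dots> \<le> card K * card U" using IWK by simp
  finally have "card I * card W \<le> card K * card U" .
  with sparse dense JI J(2) Jspan JU U(1,2) show ?thesis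
    by (intro exI[of _ U] exI[of _ J]) auto
qed

section \<open>Zero patterns\<close>

text \<open>The bound \<open>e\<close> is on the degree in each variable separately rather than on
  the total degree, so the admissible exponents form a box with \<open>(e + 1) ^ card Y\<close>
  elements.\<close>

inductive poly_fun :: "'y set \<Rightarrow> nat \<Rightarrow> (('y \<Rightarrow> real) \<Rightarrow> real) \<Rightarrow> bool" for Y e where
  monom: "(\<And>y. y \<in> Y \<Longrightarrow> \<alpha> y \<le> e) \<Longrightarrow> poly_fun Y e (\<lambda>v. c * (\<Prod>y\<in>Y. v y ^ \<alpha> y))"
| add: "poly_fun Y e f \<Longrightarrow> poly_fun Y e g \<Longrightarrow> poly_fun Y e (\<lambda>v. f v + g v)"

lemma poly_fun_const: "poly_fun Y e (\<lambda>v. c)"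
  using poly_fun.monom[of Y "\<lambda>_. 0" e c] by simp

lemma poly_fun_var:
  assumes "finite Y" "y \<in> Y"
  shows "poly_fun Y (Suc 0) (\<lambda>v. v y)"
proof -
  have "(\<Prod>x\<in>Y. v x ^ of_bool (x = y)) = v y" for v :: "'a \<Rightarrow> real"
    using assms by (subst prod.remove[of _ y]) (auto intro!: prod.neutral)
  then show ?thesis using poly_fun.monom[of Y "\<lambda>x. of_bool (x = y)" "Suc 0" 1] by simp
qed

lemma poly_fun_mono:
  assumes "poly_fun Y e f" "e \<le> e'"
  shows "poly_fun Y e' f"
  using assms(1)
proof induction
  case (monom \<alpha> c)
  then show ?case using assms(2) by (intro poly_fun.monom) (meson order_trans)
qed (rule poly_fun.add)

lemma poly_fun_monom_mult:
  assumes "poly_fun Y e g" "\<And>y. y \<in> Y \<Longrightarrow> \<alpha> y \<le> d"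
  shows "poly_fun Y (d + e) (\<lambda>v. c * (\<Prod>y\<in>Y. v y ^ \<alpha> y) * g v)"
  using assms(1)
proof induction
  case (monom \<beta> c')
  have "poly_fun Y (d + e) (\<lambda>v. (c * c') * (\<Prod>y\<in>Y. v y ^ (\<alpha> y + \<beta> y)))"
    by (rule poly_fun.monom) (use assms(2) monom in \<open>auto intro: add_mono\<close>)
  then show ?case by (simp add: power_add prod.distrib mult_ac)
next
  case (add f g)
  from poly_fun.add[OF add.IH] show ?case by (simp add: distrib_left)
qed

lemma poly_fun_mult:
  assumes "poly_fun Y d f" "poly_fun Y e g"
  shows "poly_fun Y (d + e) (\<lambda>v. f v * g v)"
  using assms(1)
proof induction
  case (monom \<alpha> c)
  then show ?case by (rule poly_fun_monom_mult[OF assms(2)])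
next
  case (add f1 f2)
  from poly_fun.add[OF add.IH] show ?case by (simp add: distrib_right)
qed

lemma poly_fun_sum:
  assumes "\<And>i. i \<in> A \<Longrightarrow> poly_fun Y e (f i)"
  shows "poly_fun Y e (\<lambda>v. \<Sum>i\<in>A. f i v)"
  using assms
  by (induction A rule: infinite_finite_induct) (auto intro: poly_fun_const poly_fun.add)

lemma poly_fun_prod:
  assumes "finite A" "\<And>i. i \<in> A \<Longrightarrow> poly_fun Y e (f i)"
  shows "poly_fun Y (card A * e) (\<lambda>v. \<Prod>i\<in>A. f i v)"
  using assms
  by (induction A rule: finite_induct) (auto intro: poly_fun_const poly_fun_mult)

text \<open>Passes from the inductive closure to one fixed finite family of monomials, whose size is
  what the dimension count needs. Extensional exponent functions give each monomial a single
  index.\<close>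

lemma poly_fun_coeffs:
  assumes "finite Y" "poly_fun Y e f"
  shows "\<exists>c. \<forall>v. f v = (\<Sum>\<alpha>\<in>Y \<rightarrow>\<^sub>E {..e}. c \<alpha> * (\<Prod>y\<in>Y. v y ^ \<alpha> y))"
  using assms(2)
proof induction
  case (monom \<alpha> c)
  have \<alpha>: "restrict \<alpha> Y \<in> Y \<rightarrow>\<^sub>E {..e}" using monom by auto
  have fin: "finite (Y \<rightarrow>\<^sub>E {..e})" using assms(1) by (intro finite_PiE) auto
  show ?case
  proof (intro exI allI)
    fix v :: "'a \<Rightarrow> real"
    have "(\<Sum>\<beta>\<in>Y \<rightarrow>\<^sub>E {..e}. (if \<beta> = restrict \<alpha> Y then c else 0) * (\<Prod>y\<in>Y. v y ^ \<beta> y))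
        = c * (\<Prod>y\<in>Y. v y ^ restrict \<alpha> Y y)"
      using \<alpha> fin by (subst sum.remove[of _ "restrict \<alpha> Y"]) auto
    also have "\<dots> = c * (\<Prod>y\<in>Y. v y ^ \<alpha> y)" by (simp cong: prod.cong)
    finally show "c * (\<Prod>y\<in>Y. v y ^ \<alpha> y) =
      (\<Sum>\<beta>\<in>Y \<rightarrow>\<^sub>E {..e}. (if \<beta> = restrict \<alpha> Y then c else 0) * (\<Prod>y\<in>Y. v y ^ \<beta> y))" ..
  qed
next
  case (add f g)
  then obtain a b where
    "\<And>v. f v = (\<Sum>\<alpha>\<in>Y \<rightarrow>\<^sub>E {..e}. a \<alpha> * (\<Prod>y\<in>Y. v y ^ \<alpha> y))"
    "\<And>v. g v = (\<Sum>\<alpha>\<in>Y \<rightarrow>\<^sub>E {..e}. b \<alpha> * (\<Prod>y\<in>Y. v y ^ \<alpha> y))" by blast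
  then show ?case
    by (intro exI[of _ "\<lambda>\<alpha>. a \<alpha> + b \<alpha>"]) (simp add: distrib_right sum.distrib)
qed

text \<open>The linear-algebra bound of Ronyai, Babai and Ganapathy: for each pattern \<open>Z\<close> the product
  of the \<open>f j\<close> with \<open>j \<in> Z\<close> vanishes at a witness of \<open>Z'\<close> unless \<open>Z \<subseteq> Z'\<close>, so these
  products are linearly independent.\<close>

lemma card_zero_patterns:
  assumes Y: "finite Y" and J: "finite J" and f: "\<And>j. j \<in> J \<Longrightarrow> poly_fun Y e (f j)"
  shows "card (range (\<lambda>v. {j\<in>J. f j v \<noteq> 0})) \<le> (card J * e + 1) ^ card Y"
proof (rule ccontr)
  define P where "P = range (\<lambda>v. {j\<in>J. f j v \<noteq> 0})"
  \<comment> \<open>A product of at most \<open>card J\<close> of the functions has degree at most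
    \<open>D\<close> in each variable.\<close>
  define D where "D = card J * e"
  assume "\<not> ?thesis"
  then have "(D + 1) ^ card Y < card P" by (simp add: P_def D_def)
  moreover have "card (Y \<rightarrow>\<^sub>E {..D}) = (D + 1) ^ card Y"
    using Y by (simp add: card_PiE)
  ultimately have less: "card (Y \<rightarrow>\<^sub>E {..D}) < card P" by simp
  have finY: "finite (Y \<rightarrow>\<^sub>E {..D})" using Y by (intro finite_PiE) auto
  have PJ: "P \<subseteq> Pow J" unfolding P_def by auto
  have finP: "finite P" using PJ J finite_subset by blast
  have "poly_fun Y D (\<lambda>v. \<Prod>j\<in>Z. f j v)" if "Z \<in> P" for Z
  proof -
    have Z: "Z \<subseteq> J" using that PJ by auto
    have "poly_fun Y (card Z * e) (\<lambda>v. \<Prod>j\<in>Z. f j v)"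
      using Z J f by (intro poly_fun_prod) (auto intro: finite_subset)
    moreover have "card Z * e \<le> D" unfolding D_def using Z J by (simp add: card_mono)
    ultimately show ?thesis by (rule poly_fun_mono)
  qed
  then have "\<forall>Z\<in>P. \<exists>c. \<forall>v. (\<Prod>j\<in>Z. f j v) = (\<Sum>\<alpha>\<in>Y \<rightarrow>\<^sub>E {..D}. c \<alpha> * (\<Prod>y\<in>Y. v y ^ \<alpha> y))"
    using poly_fun_coeffs[OF Y] by blast
  from bchoice[OF this] obtain c where c: "\<forall>Z\<in>P. \<forall>v.
      (\<Prod>j\<in>Z. f j v) = (\<Sum>\<alpha>\<in>Y \<rightarrow>\<^sub>E {..D}. c Z \<alpha> * (\<Prod>y\<in>Y. v y ^ \<alpha> y))" ..
  obtain z where z: "\<exists>Z\<in>P. z Z \<noteq> 0" "\<And>\<alpha>. \<alpha> \<in> Y \<rightarrow>\<^sub>E {..D} \<Longrightarrow> (\<Sum>Z\<in>P. z Z * c Z \<alpha>) = 0"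
    using homogeneous_system_nontrivial[OF finY finP less, of c] by blast
  have rel: "(\<Sum>Z\<in>P. z Z * (\<Prod>j\<in>Z. f j v)) = 0" for v
  proof -
    have "(\<Sum>Z\<in>P. z Z * (\<Prod>j\<in>Z. f j v)) =
        (\<Sum>Z\<in>P. \<Sum>\<alpha>\<in>Y \<rightarrow>\<^sub>E {..D}. z Z * c Z \<alpha> * (\<Prod>y\<in>Y. v y ^ \<alpha> y))"
      by (intro sum.cong refl) (simp add: c sum_distrib_left mult.assoc)
    also have "\<dots> = (\<Sum>\<alpha>\<in>Y \<rightarrow>\<^sub>E {..D}. (\<Sum>Z\<in>P. z Z * c Z \<alpha>) * (\<Prod>y\<in>Y. v y ^ \<alpha> y))"
      by (subst sum.swap) (simp add: sum_distrib_right)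
    finally show ?thesis using z(2) by simp
  qed
  \<comment> \<open>At its own witness, an inclusion-minimal pattern with nonzero coefficient is the
    only surviving term: every other such pattern contains some \<open>j\<close> outside
    \<open>Z\<close>, where \<open>f j v\<close> is 0.\<close>
  have "\<exists>Z\<in>{Z\<in>P. z Z \<noteq> 0}. \<forall>Z'\<in>{Z\<in>P. z Z \<noteq> 0}. Z' \<subseteq> Z \<longrightarrow> Z = Z'"
    using z(1) finP by (intro finite_has_minimal) auto
  then obtain Z where Z: "Z \<in> P" "z Z \<noteq> 0"
    and min: "\<And>Z'. Z' \<in> P \<Longrightarrow> z Z' \<noteq> 0 \<Longrightarrow> Z' \<subseteq> Z \<Longrightarrow> Z = Z'" by auto
  obtain v where v: "Z = {j\<in>J. f j v \<noteq> 0}" using Z(1) by (auto simp: P_def)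
  have finZ: "finite Z'" if "Z' \<in> P" for Z' using that PJ J finite_subset by blast
  have "z Z' * (\<Prod>j\<in>Z'. f j v) = 0" if "Z' \<in> P - {Z}" for Z'
  proof (cases "z Z' = 0")
    case False
    then have "\<not> Z' \<subseteq> Z" using min[of Z'] that by auto
    then obtain j where j: "j \<in> Z'" "j \<notin> Z" by auto
    moreover have "j \<in> J" using j that PJ by auto
    ultimately have "f j v = 0" using v by auto
    then show ?thesis using finZ that j by auto
  qed simp
  then have "(\<Sum>Z'\<in>P - {Z}. z Z' * (\<Prod>j\<in>Z'. f j v)) = 0" by (intro sum.neutral) blast
  then have "(\<Sum>Z'\<in>P. z Z' * (\<Prod>j\<in>Z'. f j v)) = z Z * (\<Prod>j\<in>Z. f j v)"
    using sum.remove[OF finP Z(1), of "\<lambda>Z'. z Z' * (\<Prod>j\<in>Z'. f j v)"] by simp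
  moreover have "(\<Prod>j\<in>Z. f j v) \<noteq> 0" using finZ[OF Z(1)] by (subst prod_zero_iff) (auto simp: v)
  ultimately show False using rel[of v] Z(2) by simp
qed

section \<open>Supports of symmetric matrices through bordered determinants\<close>

lemma poly_fun_det:
  assumes "finite Y" "\<And>i j. i < n \<Longrightarrow> j < n \<Longrightarrow> poly_fun Y e (\<lambda>v. m v i j)"
  shows "poly_fun Y (n * e) (\<lambda>v. Determinant.det (Matrix.mat n n (\<lambda>(i, j). m v i j)))"
proof -
  have "poly_fun Y (n * e) (\<lambda>v. \<Sum>p\<in>{p. p permutes {0..<n}}. signof p * (\<Prod>i = 0..<n. m v i (p i)))"
  proof (intro poly_fun_sum)
    fix p assume "p \<in> {p. p permutes {0..<n}}"
    then have p: "p i < n" if "i < n" for i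
      using that permutes_in_image[of p "{0..<n}" i] by auto
    have "poly_fun Y (card {0..<n} * e) (\<lambda>v. \<Prod>i = 0..<n. m v i (p i))"
      using assms(2) p by (intro poly_fun_prod) auto
    then show "poly_fun Y (n * e) (\<lambda>v. signof p * (\<Prod>i = 0..<n. m v i (p i)))"
      using poly_fun_mult[OF poly_fun_const[of Y 0]] by simp
  qed
  also have "(\<lambda>v. \<Sum>p\<in>{p. p permutes {0..<n}}. signof p * (\<Prod>i = 0..<n. m v i (p i))) =
     (\<lambda>v. Determinant.det (Matrix.mat n n (\<lambda>(i, j). m v i j)))"
  proof (rule ext)
    fix v
    have eq: "m v i (p i) = Matrix.mat n n (\<lambda>(i, j). m v i j) $$ (i, p i)"
      if "p \<in> {p. p permutes {0..<n}}" "i \<in> {0..<n}" for p i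
      using that permutes_in_image[of p "{0..<n}" i] by simp
    show "(\<Sum>p\<in>{p. p permutes {0..<n}}. signof p * (\<Prod>i = 0..<n. m v i (p i))) =
        Determinant.det (Matrix.mat n n (\<lambda>(i, j). m v i j))"
      by (subst det_def'[of _ n])
         (simp, intro sum.cong refl arg_cong2[where f="(*)"] prod.cong, rule eq)
  qed
  finally show ?thesis .
qed

text \<open>If the rows in \<open>I\<close> form a basis then \<open>A = M[I,I]\<close> is invertible and \<open>M i j = R\<^sub>i\<^sup>T A\<inverse> R\<^sub>j\<close>
  where \<open>R = M[I,U]\<close>. Bordering \<open>A\<close> by \<open>R\<^sub>i\<close> and \<open>R\<^sub>j\<close> turns the non-vanishing of \<open>M i j\<close>
  into the non-vanishing of a polynomial in the entries of \<open>R\<close>.\<close>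

definition bordered :: "(nat \<Rightarrow> nat \<Rightarrow> real) \<Rightarrow> (nat \<Rightarrow> nat) \<Rightarrow> nat \<Rightarrow> nat \<Rightarrow> nat \<Rightarrow> real mat" where
  "bordered R h k i j = Matrix.mat (Suc k) (Suc k) (\<lambda>(a, b).
     if a < k then R (h a) (if b < k then h b else j) else if b < k then R (h b) i else 0)"

text \<open>A symmetric matrix attains its rank on the principal submatrix of a row basis. By
  symmetry each column in \<open>U\<close> is a combination of the columns in \<open>I\<close>, so a
  row relation valid on the columns \<open>I\<close> is valid on all of \<open>U\<close>, and
  independence applies.\<close>

lemma principal_kernel_trivial:
  assumes "finite I" "I \<subseteq> U" and sym: "\<And>i j. i \<in> U \<Longrightarrow> j \<in> U \<Longrightarrow> M i j = M j i"
    and ind: "row_indep M U I" and span: "\<And>j. j \<in> U \<Longrightarrow> in_row_span M U I j"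
    and z: "\<And>l. l \<in> I \<Longrightarrow> (\<Sum>a\<in>I. z a * M a l) = 0" and "a \<in> I"
  shows "z a = 0"
proof (rule row_indepD[OF ind _ \<open>a \<in> I\<close>])
  fix l assume l: "l \<in> U"
  from span[OF l] obtain c where c: "\<And>j. j \<in> U \<Longrightarrow> M l j = (\<Sum>b\<in>I. c b * M b j)"
    unfolding in_row_span_def by blast
  have "(\<Sum>a\<in>I. z a * M a l) = (\<Sum>a\<in>I. z a * M l a)"
    using sym l assms(2) by (intro sum.cong) auto
  also have "\<dots> = (\<Sum>a\<in>I. \<Sum>b\<in>I. z a * c b * M b a)"
    using c assms(2) by (intro sum.cong) (auto simp: sum_distrib_left mult_ac)
  also have "\<dots> = (\<Sum>b\<in>I. c b * (\<Sum>a\<in>I. z a * M b a))"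
    by (subst sum.swap) (simp add: sum_distrib_left mult_ac)
  also have "\<dots> = (\<Sum>b\<in>I. c b * (\<Sum>a\<in>I. z a * M a b))"
    using sym assms(2) by (intro sum.cong refl arg_cong2[where f="(*)"]) auto
  also have "\<dots> = 0" using z by simp
  finally show "(\<Sum>a\<in>I. z a * M a l) = 0" .
qed

text \<open>Argued through the kernel. If \<open>c\<close> expresses row \<open>j\<close> in the
  basis, the first \<open>k\<close> coordinates force every kernel vector to be a multiple of
  \<open>(c, -1)\<close>, and the last coordinate of the image of \<open>(c, -1)\<close> is
  \<open>M j i = M i j\<close>. So a nonzero kernel vector exists exactly when this entry is
  0.\<close>

lemma det_bordered_nonzero_iff:
  assumes U: "I \<subseteq> U" and sym: "\<And>i j. i \<in> U \<Longrightarrow> j \<in> U \<Longrightarrow> M i j = M j i"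
    and ind: "row_indep M U I" and span: "\<And>j. j \<in> U \<Longrightarrow> in_row_span M U I j"
    and h: "bij_betw h {0..<k} I" and i: "i \<in> U" and j: "j \<in> U"
  shows "Determinant.det (bordered M h k i j) \<noteq> 0 \<longleftrightarrow> M i j \<noteq> 0"
proof -
  have fI: "finite I" using h bij_betw_finite by blast
  have hI: "h a \<in> I" "h a \<in> U" if "a < k" for a using h that U by (auto simp: bij_betw_def)
  have re: "(\<Sum>a\<in>I. F a) = (\<Sum>a = 0..<k. F (h a))" for F :: "nat \<Rightarrow> real"
    using sum.reindex_bij_betw[OF h, of F] by simp
  have carr: "bordered M h k i j \<in> carrier_mat (Suc k) (Suc k)" by (simp add: bordered_def)
  from span[OF j] obtain c where c: "\<And>l. l \<in> U \<Longrightarrow> M j l = (\<Sum>a\<in>I. c a * M a l)"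
    unfolding in_row_span_def by blast
  have mv_lt: "(bordered M h k i j *\<^sub>v x) $ a = (\<Sum>b = 0..<k. x $ b * M (h a) (h b)) + x $ k * M (h a) j"
    if "x \<in> carrier_vec (Suc k)" "a < k" for x a
  proof -
    have "(bordered M h k i j *\<^sub>v x) $ a = (\<Sum>b = 0..<Suc k. (if b < k then M (h a) (h b) else M (h a) j) * x $ b)"
      using that by (auto simp: bordered_def scalar_prod_def intro!: sum.cong)
    then show ?thesis by (simp add: mult_ac)
  qed
  have mv_k: "(bordered M h k i j *\<^sub>v x) $ k = (\<Sum>b = 0..<k. x $ b * M (h b) i)"
    if "x \<in> carrier_vec (Suc k)" for x
  proof -
    have "(bordered M h k i j *\<^sub>v x) $ k = (\<Sum>b = 0..<Suc k. (if b < k then M (h b) i else 0) * x $ b)"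
      using that by (auto simp: bordered_def scalar_prod_def intro!: sum.cong)
    then show ?thesis by (simp add: mult_ac)
  qed
  have Mc: "(\<Sum>a = 0..<k. c (h a) * M (h a) l) = M j l" if "l \<in> U" for l
    using c[OF that] re[of "\<lambda>a. c a * M a l"] by simp
  have "Determinant.det (bordered M h k i j) = 0 \<longleftrightarrow> M i j = 0"
  proof
    assume "Determinant.det (bordered M h k i j) = 0"
    then obtain x where x: "x \<in> carrier_vec (Suc k)" "x \<noteq> 0\<^sub>v (Suc k)"
      "bordered M h k i j *\<^sub>v x = 0\<^sub>v (Suc k)"
      using det_0_iff_vec_prod_zero[OF carr] by blast
    define t where "t = x $ k"
    have eq: "(\<Sum>b = 0..<k. (x $ b + t * c (h b)) * M (h b) l) = 0" if l: "l \<in> I" for l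
    proof -
      obtain a where a: "a < k" "l = h a" using h l by (auto simp: bij_betw_def)
      have lU: "l \<in> U" using l U by auto
      have "0 = (\<Sum>b = 0..<k. x $ b * M l (h b)) + t * M l j"
        using mv_lt[OF x(1) a(1)] x(3) a by (simp add: t_def)
      also have "\<dots> = (\<Sum>b = 0..<k. x $ b * M (h b) l) + t * (\<Sum>b = 0..<k. c (h b) * M (h b) l)"
        unfolding Mc[OF lU] using sym[OF lU] hI j by (auto intro!: sum.cong)
      finally show ?thesis by (simp add: distrib_right sum.distrib sum_distrib_left mult.assoc)
    qed
    have inj: "inj_on h {0..<k}" using h by (simp add: bij_betw_def)
    \<comment> \<open>The relation \<open>eq\<close> lives on positions below \<open>k\<close>;
      \<open>z\<close> carries it over to the index set \<open>I\<close>.\<close>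
    define z where "z a = x $ (inv_into {0..<k} h a) + t * c a" for a
    have zh: "z (h b) = x $ b + t * c (h b)" if "b < k" for b
      using that inj by (simp add: z_def inv_into_f_f)
    have zero: "z a = 0" if "a \<in> I" for a
    proof (rule principal_kernel_trivial[OF fI U sym ind span _ that])
      fix l assume "l \<in> I"
      then show "(\<Sum>a\<in>I. z a * M a l) = 0"
        unfolding re using eq[of l] by (simp add: zh)
    qed auto
    have xb: "x $ b = - t * c (h b)" if "b < k" for b
      using zero[OF hI(1)[OF that]] zh[OF that] by simp
    have "t \<noteq> 0"
    proof
      assume "t = 0"
      then have "x $ b = 0" if "b < Suc k" for b
        using that xb[of b] by (cases "b = k") (auto simp: t_def)
      then show False using x(1,2) by (auto intro!: eq_vecI)
    qed
    have "0 = (\<Sum>b = 0..<k. x $ b * M (h b) i)"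
      using mv_k[OF x(1)] x(3) by simp
    also have "\<dots> = - t * (\<Sum>b = 0..<k. c (h b) * M (h b) i)"
      unfolding sum_distrib_left using xb by (intro sum.cong) auto
    finally show "M i j = 0" using \<open>t \<noteq> 0\<close> Mc[OF i] sym[OF i j] by simp
  next
    assume 0: "M i j = 0"
    define x where "x = Matrix.vec (Suc k) (\<lambda>b. if b < k then c (h b) else - 1)"
    have xc: "x \<in> carrier_vec (Suc k)" by (simp add: x_def)
    have "x $ k = - 1" by (simp add: x_def)
    then have "x \<noteq> 0\<^sub>v (Suc k)" by auto
    moreover have "bordered M h k i j *\<^sub>v x = 0\<^sub>v (Suc k)"
    proof (rule eq_vecI)
      fix a assume "a < dim_vec (0\<^sub>v (Suc k))"
      then consider "a < k" | "a = k" by force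
      then show "(bordered M h k i j *\<^sub>v x) $ a = 0\<^sub>v (Suc k) $ a"
      proof cases
        case 1
        have "(\<Sum>b = 0..<k. x $ b * M (h a) (h b)) = (\<Sum>b = 0..<k. c (h b) * M (h b) (h a))"
          using hI 1 sym[OF hI(2)[OF 1]] by (intro sum.cong) (auto simp: x_def)
        then show ?thesis
          using 1 mv_lt[OF xc 1] Mc[OF hI(2)[OF 1]] sym[OF hI(2)[OF 1] j] by (simp add: x_def)
      next
        case 2
        have "(\<Sum>b = 0..<k. x $ b * M (h b) i) = (\<Sum>b = 0..<k. c (h b) * M (h b) i)"
          by (intro sum.cong) (auto simp: x_def)
        then show ?thesis using 2 mv_k[OF xc] Mc[OF i] 0 sym[OF i j] by simp
      qed
    qed (simp add: bordered_def)
    ultimately show "Determinant.det (bordered M h k i j) = 0"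
      using det_0_iff_vec_prod_zero[OF carr] xc by blast
  qed
  then show ?thesis by blast
qed

definition patterns :: "nat set \<Rightarrow> nat set \<Rightarrow> (nat \<times> nat) set \<Rightarrow> (nat \<times> nat) set set" where
  "patterns U I S = {supp M U U | M. (\<forall>i\<in>U. \<forall>j\<in>U. M i j = M j i) \<and> row_indep M U I \<and>
     (\<forall>j\<in>U. in_row_span M U I j) \<and> supp M I U = S}"

text \<open>Entries of the basis rows outside \<open>S\<close> are 0, so only \<open>card S\<close>
  variables remain. The support on \<open>U\<close> is the zero pattern of
  \<open>card U * card U\<close> determinants of size \<open>card I + 1\<close> with linear entries,
  to which \<open>card_zero_patterns\<close> applies. This is why a sparse basis pays off.\<close>

lemma card_patterns:
  assumes U: "finite U" and I: "I \<subseteq> U" and S: "S \<subseteq> I \<times> U"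
  shows "card (patterns U I S) \<le> (card U * card U * (card I + 1) + 1) ^ card S"
proof -
  have fI: "finite I" using assms finite_subset by blast
  have fS: "finite S" using S fI U finite_subset by blast
  obtain h where h: "bij_betw h {0..<card I} I" using ex_bij_betw_nat_finite[OF fI] by blast
  define R where "R v = (\<lambda>a b. if (a, b) \<in> S then v (a, b) else 0)" for v :: "nat \<times> nat \<Rightarrow> real"
  define f where "f = (\<lambda>(i, j) v. Determinant.det (bordered (R v) h (card I) i j))"
  have pR: "poly_fun S 1 (\<lambda>v. R v a b)" for a b
    unfolding R_def using poly_fun_var[OF fS] poly_fun_const by (cases "(a, b) \<in> S") auto
  have "poly_fun S (Suc (card I) * 1) (f p)" for p
  proof (cases p)
    case (Pair i j)
    have "poly_fun S 1 (\<lambda>v. if a < card I then R v (h a) (if b < card I then h b else j)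
        else if b < card I then R v (h b) i else 0)" for a b
      by (cases "a < card I"; cases "b < card I") (simp_all only: if_True if_False pR poly_fun_const)
    then show ?thesis
      unfolding f_def bordered_def Pair prod.case by (rule poly_fun_det[OF fS])
  qed
  then have bound: "card (range (\<lambda>v. {p\<in>U \<times> U. f p v \<noteq> 0})) \<le> (card (U \<times> U) * (Suc (card I)) + 1) ^ card S"
    using U by (intro card_zero_patterns fS) auto
  have sub: "patterns U I S \<subseteq> range (\<lambda>v. {p\<in>U \<times> U. f p v \<noteq> 0})"
  proof
    fix Z assume "Z \<in> patterns U I S"
    then obtain M where Z: "Z = supp M U U" and M: "\<And>i j. i \<in> U \<Longrightarrow> j \<in> U \<Longrightarrow> M i j = M j i"
      "row_indep M U I" "\<And>j. j \<in> U \<Longrightarrow> in_row_span M U I j" and SM: "supp M I U = S"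
      unfolding patterns_def by blast
    have RM: "R (\<lambda>(a, b). M a b) a b = M a b" if "a \<in> I" "b \<in> U" for a b
      using that SM by (auto simp: R_def supp_def)
    have "f (i, j) (\<lambda>(a, b). M a b) \<noteq> 0 \<longleftrightarrow> M i j \<noteq> 0" if ij: "i \<in> U" "j \<in> U" for i j
    proof -
      have hI: "h a \<in> I" "h a \<in> U" if "a < card I" for a using h that I by (auto simp: bij_betw_def)
      have "bordered (R (\<lambda>(a, b). M a b)) h (card I) i j = bordered M h (card I) i j"
        unfolding bordered_def using ij hI RM by (intro eq_matI) auto
      then show ?thesis
        unfolding f_def using det_bordered_nonzero_iff[OF I M h ij] by simp
    qed
    then have "Z = {p\<in>U \<times> U. f p (\<lambda>(a, b). M a b) \<noteq> 0}"
      unfolding Z supp_def by auto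
    then show "Z \<in> range (\<lambda>v. {p\<in>U \<times> U. f p v \<noteq> 0})" by blast
  qed
  have fin: "finite (range (\<lambda>v. {p\<in>U \<times> U. f p v \<noteq> 0}))"
    by (rule finite_subset[of _ "Pow (U \<times> U)"]) (use U in auto)
  from le_trans[OF card_mono[OF fin sub] bound] show ?thesis
    by (simp add: card_cartesian_product)
qed

section \<open>Colourings of random graphs\<close>

definition colourable :: "nat \<Rightarrow> nat \<Rightarrow> nat set set \<Rightarrow> bool" where
  "colourable n k E \<longleftrightarrow> (\<exists>\<kappa>. (\<forall>i\<in>{1..n}. \<kappa> i < k) \<and>
     (\<forall>i\<in>{1..n}. \<forall>j\<in>{1..n}. {i, j} \<in> E \<longrightarrow> \<kappa> i \<noteq> (\<kappa> j :: nat)))"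

lemma touching_spheres_if_colourable:
  assumes "colourable n k E"
  shows "touching_spheres n E k"
proof -
  obtain \<kappa> where \<kappa>: "\<And>i. i \<in> {1..n} \<Longrightarrow> \<kappa> i < k"
    "\<And>i j. i \<in> {1..n} \<Longrightarrow> j \<in> {1..n} \<Longrightarrow> {i, j} \<in> E \<Longrightarrow> \<kappa> i \<noteq> \<kappa> j"
    using assms unfolding colourable_def by metis
  \<comment> \<open>Distinct points \<open>e_c / sqrt 2\<close> are at distance 1, which suits radii
    1/2. Vertices of one colour share a centre, as nonadjacent pairs are unconstrained.\<close>
  define u where "u i l = (if l = \<kappa> i then 1 / sqrt 2 else 0)" for i l :: nat
  have "dist_d k (u i) (u j) = 1" if ij: "i \<in> {1..n}" "j \<in> {1..n}" "{i, j} \<in> E" for i j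
  proof -
    have ne: "\<kappa> i \<noteq> \<kappa> j" using \<kappa>(2) ij by blast
    have "(\<Sum>l<k. (u i l - u j l)\<^sup>2) = (\<Sum>l\<in>{\<kappa> i, \<kappa> j}. (u i l - u j l)\<^sup>2)"
      using \<kappa>(1) ij by (intro sum.mono_neutral_right) (auto simp: u_def)
    also have "\<dots> = 1" using ne by (simp add: u_def power_divide)
    finally show ?thesis by (simp add: dist_d_def)
  qed
  then show ?thesis
    unfolding touching_spheres_def by (intro exI[of _ u] exI[of _ "\<lambda>_. 1/2"]) auto
qed

text \<open>Fubini in the form of conditioning: the first coordinate is the part already exposed,
  and the bound on the fresh second part is uniform over it.\<close>

lemma prob_pair_pmf_le:
  assumes "\<And>x. P x \<Longrightarrow> measure_pmf.prob N {y. R x y} \<le> \<delta>" "0 \<le> \<delta>"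
  shows "measure_pmf.prob (pair_pmf M N) {(x, y). P x \<and> R x y} \<le> measure_pmf.prob M {x. P x} * \<delta>"
proof -
  have "emeasure (pair_pmf M N) {(x, y). P x \<and> R x y} =
      (\<integral>\<^sup>+x. indicator {(x, y). P x \<and> R x y} x \<partial>pair_pmf M N)" by simp
  also have "\<dots> = (\<integral>\<^sup>+x. (\<integral>\<^sup>+y. indicator {(x, y). P x \<and> R x y} (x, y) \<partial>N) \<partial>M)"
    by (rule nn_integral_pair_pmf')
  also have "\<dots> \<le> (\<integral>\<^sup>+x. ennreal \<delta> * indicator {x. P x} x \<partial>M)"
  proof (intro nn_integral_mono)
    fix x
    show "(\<integral>\<^sup>+y. indicator {(x, y). P x \<and> R x y} (x, y) \<partial>N) \<le> ennreal \<delta> * indicator {x. P x} x"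
    proof (cases "P x")
      case True
      have "(\<integral>\<^sup>+y. indicator {(x, y). P x \<and> R x y} (x, y) \<partial>N) = (\<integral>\<^sup>+y. indicator {y. R x y} y \<partial>N)"
        using True by (intro nn_integral_cong) (auto simp: indicator_def)
      also have "\<dots> = emeasure N {y. R x y}" by simp
      also have "\<dots> \<le> ennreal \<delta>"
        unfolding measure_pmf.emeasure_eq_measure using assms(1)[OF True] by (intro ennreal_leI)
      finally show ?thesis using True by simp
    qed (simp add: indicator_def)
  qed
  also have "\<dots> = ennreal (measure_pmf.prob M {x. P x} * \<delta>)"
    using assms(2) by (simp add: nn_integral_cmult measure_pmf.emeasure_eq_measure
      ennreal_mult'[symmetric] mult.commute)
  finally show ?thesis
    unfolding measure_pmf.emeasure_eq_measure using assms(2) by (subst (asm) ennreal_le_iff) auto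
qed

lemma prob_Pi_bernoulli_none:
  assumes "finite A" "B \<subseteq> A" "0 \<le> p" "p \<le> 1"
  shows "measure_pmf.prob (Pi_pmf A False (\<lambda>_. bernoulli_pmf p)) {f. \<forall>y\<in>B. \<not> f y} = (1 - p) ^ card B"
proof -
  have "{f. \<forall>y\<in>B. \<not> f y} = Pi A (\<lambda>y. if y \<in> B then {False} else UNIV)"
    using assms(2) by (fastforce simp: Pi_iff)
  then have "measure_pmf.prob (Pi_pmf A False (\<lambda>_. bernoulli_pmf p)) {f. \<forall>y\<in>B. \<not> f y} =
      (\<Prod>y\<in>A. measure_pmf.prob (bernoulli_pmf p) (if y \<in> B then {False} else UNIV))"
    using assms(1) by (simp add: measure_Pi_pmf_Pi)
  also have "\<dots> = (\<Prod>y\<in>A. if y \<in> B then 1 - p else 1)"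
    using assms by (intro prod.cong) (auto simp: measure_pmf_single)
  also have "\<dots> = (1 - p) ^ card B"
    using assms(1,2) by (simp add: prod.If_cases Int_absorb1)
  finally show ?thesis .
qed

text \<open>Disjoint blocks are independent; the last one is split off and the rest goes by
  induction. In the application \<open>B c\<close> is the set of possible edges from a new vertex to
  colour class \<open>c\<close>, so the event says that every colour is blocked.\<close>

lemma prob_Pi_bernoulli_hit_all:
  fixes k :: nat
  assumes "finite A" "\<forall>c<k. B c \<subseteq> A" "\<forall>d<k. \<forall>c<d. B c \<inter> B d = {}"
    and p: "0 \<le> p" "p \<le> 1"
  shows "measure_pmf.prob (Pi_pmf A False (\<lambda>_. bernoulli_pmf p)) {f. \<forall>c<k. \<exists>y\<in>B c. f y}
     \<le> (\<Prod>c<k. 1 - (1 - p) ^ card (B c))"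
  using assms(1-3)
proof (induction k arbitrary: A)
  case (Suc k)
  let ?P = "\<lambda>A. Pi_pmf A False (\<lambda>_. bernoulli_pmf p)"
  let ?A = "A - B k"
  have fin: "finite ?A" "finite (B k)" and AB: "A = ?A \<union> B k"
    using Suc.prems(1,2) finite_subset[of "B k" A] by auto
  have sub: "B c \<subseteq> ?A" if "c < k" for c
  proof -
    have "B c \<subseteq> A" "B c \<inter> B k = {}" using Suc.prems(2,3) that by auto
    then show ?thesis by auto
  qed
  have pow: "(1 - p) ^ j \<le> 1" for j using p by (simp add: power_le_one)
  have none: "measure_pmf.prob (?P (B k)) {g. \<exists>y\<in>B k. g y} = 1 - (1 - p) ^ card (B k)"
  proof -
    have "{g. \<exists>y\<in>B k. g y} = UNIV - {g. \<forall>y\<in>B k. \<not> g y}" by auto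
    then show ?thesis
      using prob_Pi_bernoulli_none[OF fin(2) order_refl p]
        measure_pmf.prob_compl[of "{g. \<forall>y\<in>B k. \<not> g y}" "?P (B k)"] by simp
  qed
  have "?P A = map_pmf (\<lambda>(f, g) x. if x \<in> ?A then f x else g x) (pair_pmf (?P ?A) (?P (B k)))"
    by (subst AB, rule Pi_pmf_union) (use fin in auto)
  then have "measure_pmf.prob (?P A) {f. \<forall>c<Suc k. \<exists>y\<in>B c. f y} =
    measure_pmf.prob (pair_pmf (?P ?A) (?P (B k)))
      ((\<lambda>(f, g) x. if x \<in> ?A then f x else g x) -` {f. \<forall>c<Suc k. \<exists>y\<in>B c. f y})"
    by (simp only: measure_map_pmf)
  also have "(\<lambda>(f, g) x. if x \<in> ?A then f x else g x) -` {f. \<forall>c<Suc k. \<exists>y\<in>B c. f y} =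
      {(f, g). (\<forall>c<k. \<exists>y\<in>B c. f y) \<and> (\<exists>y\<in>B k. g y)}"
  proof -
    define F where "F f g x = (if x \<in> ?A then f x else g x)" for f g :: "'a \<Rightarrow> bool" and x
    have "(\<exists>y\<in>B c. F f g y) \<longleftrightarrow> (\<exists>y\<in>B c. f y)" if "c < k" for c f g
      using sub[OF that] by (auto simp: F_def)
    moreover have "(\<exists>y\<in>B k. F f g y) \<longleftrightarrow> (\<exists>y\<in>B k. g y)" for f g
      by (auto simp: F_def)
    ultimately have "(\<forall>c<Suc k. \<exists>y\<in>B c. F f g y) \<longleftrightarrow>
        (\<forall>c<k. \<exists>y\<in>B c. f y) \<and> (\<exists>y\<in>B k. g y)" for f g
      by (auto simp: less_Suc_eq)
    then show ?thesis
      unfolding F_def set_eq_iff split_paired_All vimage_eq prod.case mem_Collect_eq by blast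
  qed
  also have "measure_pmf.prob (pair_pmf (?P ?A) (?P (B k))) \<dots> \<le>
      measure_pmf.prob (?P ?A) {f. \<forall>c<k. \<exists>y\<in>B c. f y} * (1 - (1 - p) ^ card (B k))"
    by (rule prob_pair_pmf_le) (use none pow in auto)
  also have "\<dots> \<le> (\<Prod>c<k. 1 - (1 - p) ^ card (B c)) * (1 - (1 - p) ^ card (B k))"
    using fin sub Suc.prems pow by (intro mult_right_mono Suc.IH) auto
  finally show ?case by simp
qed simp

text \<open>The tangent line of the exponential at \<open>n / k\<close> replaces the class sizes by their average.\<close>

lemma prod_one_minus_power_le:
  fixes q :: real and s :: "nat \<Rightarrow> nat"
  assumes q: "0 < q" "q \<le> 1" and k: "0 < k" and s: "(\<Sum>c<k. s c) \<le> n"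
  shows "(\<Prod>c<k. 1 - q ^ s c) \<le> exp (- (k * exp (real n / k * ln q)))"
proof -
  define t where "t = real n / k"
  have lnq: "ln q \<le> 0" using q by simp
  have tan: "exp (t * ln q) * (1 + (real (s c) - t) * ln q) \<le> q ^ s c" for c
  proof -
    have "exp (t * ln q) * (1 + (real (s c) - t) * ln q) \<le> exp (t * ln q) * exp ((real (s c) - t) * ln q)"
      by (intro mult_left_mono exp_ge_add_one_self) simp
    also have "\<dots> = exp (real (s c) * ln q)"
      by (simp add: exp_add[symmetric] algebra_simps)
    also have "\<dots> = q ^ s c" using q by (simp add: exp_of_nat_mult)
    finally show ?thesis .
  qed
  have "real (\<Sum>c<k. s c) \<le> real n" using s by (simp only: of_nat_le_iff)
  then have le: "(\<Sum>c<k. real (s c)) - k * t \<le> 0" using k by (simp add: t_def)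
  have "k * exp (t * ln q) \<le> exp (t * ln q) * (k + ((\<Sum>c<k. real (s c)) - k * t) * ln q)"
    using mult_left_mono[OF mult_nonpos_nonpos[OF le lnq], of "exp (t * ln q)"]
    by (simp add: distrib_left mult.commute)
  also have "\<dots> = (\<Sum>c<k. exp (t * ln q) * (1 + (real (s c) - t) * ln q))"
    by (simp add: sum_distrib_left[symmetric] sum.distrib sum_distrib_right[symmetric] sum_subtractf)
  also have "\<dots> \<le> (\<Sum>c<k. q ^ s c)" by (intro sum_mono tan)
  finally have main: "k * exp (t * ln q) \<le> (\<Sum>c<k. q ^ s c)" .
  have "(\<Prod>c<k. 1 - q ^ s c) \<le> (\<Prod>c<k. exp (- (q ^ s c)))"
  proof (intro prod_mono conjI)
    fix c
    show "0 \<le> 1 - q ^ s c" using q by (simp add: power_le_one)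
    show "1 - q ^ s c \<le> exp (- (q ^ s c))" using exp_ge_add_one_self[of "- (q ^ s c)"] by simp
  qed
  also have "\<dots> = exp (- (\<Sum>c<k. q ^ s c))" by (simp add: exp_sum sum_negf[symmetric])
  also have "\<dots> \<le> exp (- (k * exp (t * ln q)))" using main by simp
  finally show ?thesis by (simp add: t_def)
qed

section \<open>Exposing the vertices one at a time\<close>

lemma finite_all_pairs: "finite (all_pairs n)"
  by (rule finite_subset[of _ "Pow {1..n}"]) (auto simp: all_pairs_def)

text \<open>Induction over the exposed vertices \<open>m\<close>, with \<open>n\<close> fixed so
  that every step costs the same amount: a colouring of the first \<open>m\<close> vertices fails to
  extend only if the new vertex has a neighbour in each class.\<close>

lemma prob_not_colourable_le:
  fixes p :: real
  assumes p: "0 \<le> p" "p < 1" and k: "0 < k" and m: "m \<le> n"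
  shows "measure_pmf.prob (Pi_pmf (all_pairs m) False (\<lambda>_. bernoulli_pmf p)) {f. \<not> colourable m k {e. f e}}
     \<le> m * exp (- (k * exp (real n / k * ln (1 - p))))"
  using m
proof (induction m)
  case 0
  have "colourable 0 k E" for E by (simp add: colourable_def)
  then show ?case by simp
next
  case (Suc m)
  define \<delta> where "\<delta> = exp (- (k * exp (real n / k * ln (1 - p))))"
  define P where "P A = Pi_pmf A False (\<lambda>_. bernoulli_pmf p)" for A :: "nat set set"
  define star where "star = (\<lambda>i. {i, Suc m}) ` {1..m}"
  define col where "col f \<longleftrightarrow> colourable m k {e. f e}" for f
  have split: "all_pairs (Suc m) = all_pairs m \<union> star"
    by (fastforce simp: all_pairs_def star_def le_Suc_eq insert_commute)
  have disj: "all_pairs m \<inter> star = {}"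
    by (auto simp: all_pairs_def star_def doubleton_eq_iff)
  have fin: "finite star" by (simp add: star_def)
  \<comment> \<open>One colouring is selected as a function of the old edges \<open>f\<close> alone,
    so the classes are independent of the edges in \<open>star\<close>.\<close>
  define \<kappa> where "\<kappa> f = (SOME c. (\<forall>i\<in>{1..m}. c i < k) \<and>
     (\<forall>i\<in>{1..m}. \<forall>j\<in>{1..m}. f {i, j} \<longrightarrow> c i \<noteq> (c j :: nat)))" for f
  have \<kappa>: "(\<forall>i\<in>{1..m}. \<kappa> f i < k) \<and> (\<forall>i\<in>{1..m}. \<forall>j\<in>{1..m}. f {i, j} \<longrightarrow> \<kappa> f i \<noteq> \<kappa> f j)" if "col f" for f
    using that someI_ex[of "\<lambda>c. (\<forall>i\<in>{1..m}. c i < k) \<and>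
      (\<forall>i\<in>{1..m}. \<forall>j\<in>{1..m}. f {i, j} \<longrightarrow> c i \<noteq> c j)"]
    unfolding \<kappa>_def col_def colourable_def mem_Collect_eq by blast
  define B where "B f c = (\<lambda>i. {i, Suc m}) ` {i\<in>{1..m}. \<kappa> f i = c}" for f c
  have inj: "inj_on (\<lambda>i. {i, Suc m}) X" if "X \<subseteq> {1..m}" for X
    using that by (force simp: inj_on_def doubleton_eq_iff)
  define R where "R f g \<longleftrightarrow> (\<forall>c<k. \<exists>y\<in>B f c. g y)" for f g
  have step: "measure_pmf.prob (P star) {g. R f g} \<le> \<delta>" if f: "col f" for f
  proof -
    have "measure_pmf.prob (P star) {g. R f g} \<le> (\<Prod>c<k. 1 - (1 - p) ^ card (B f c))"
      unfolding P_def R_def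
    proof (rule prob_Pi_bernoulli_hit_all[OF fin])
      show "\<forall>d<k. \<forall>c<d. B f c \<inter> B f d = {}"
        by (auto simp: B_def doubleton_eq_iff)
    qed (use p in \<open>auto simp: B_def star_def\<close>)
    also have "\<dots> \<le> \<delta>"
      unfolding \<delta>_def
    proof (rule prod_one_minus_power_le)
      have "(\<Sum>c<k. card (B f c)) = (\<Sum>c<k. card {i\<in>{1..m}. \<kappa> f i = c})"
        unfolding B_def by (intro sum.cong refl card_image inj) auto
      also have "\<dots> = card (\<Union>c\<in>{..<k}. {i\<in>{1..m}. \<kappa> f i = c})"
        by (subst card_UN_disjoint) auto
      also have "\<dots> \<le> card {1..m}" by (intro card_mono) auto
      finally show "(\<Sum>c<k. card (B f c)) \<le> n" using Suc.prems by simp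
    qed (use p k in auto)
    finally show ?thesis .
  qed
  have extend: "colourable (Suc m) k {e. if e \<in> all_pairs m then f e else g e}"
    if f: "col f" and g: "\<not> R f g" and fg: "\<forall>e. e \<notin> all_pairs m \<longrightarrow> \<not> f e" "\<forall>e. e \<notin> star \<longrightarrow> \<not> g e" for f g
  proof -
    obtain c where c: "c < k" "\<And>i. i \<in> {1..m} \<Longrightarrow> \<kappa> f i = c \<Longrightarrow> \<not> g {i, Suc m}"
      using g by (auto simp: R_def B_def)
    let ?c = "(\<kappa> f)(Suc m := c)"
    have "?c i \<noteq> ?c j" if ij: "i \<in> {1..Suc m}" "j \<in> {1..Suc m}"
      and e: "if {i, j} \<in> all_pairs m then f {i, j} else g {i, j}" for i j
    proof (cases "{i, j} \<in> all_pairs m")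
      case True
      then have "i \<in> {1..m}" "j \<in> {1..m}" by (auto simp: all_pairs_def doubleton_eq_iff)
      then show ?thesis using \<kappa>[OF f] e True by auto
    next
      case False
      then have "g {i, j}" using e by simp
      then have "{i, j} \<in> star" using fg(2) by blast
      then obtain l where "l \<in> {1..m}" "{i, j} = {l, Suc m}" by (auto simp: star_def)
      then have "i \<in> {1..m} \<and> j = Suc m \<or> j \<in> {1..m} \<and> i = Suc m"
        by (auto simp: doubleton_eq_iff)
      then show ?thesis using c(2) \<open>g {i, j}\<close> by (auto simp: insert_commute)
    qed
    moreover have "?c i < k" if "i \<in> {1..Suc m}" for i
      using that c(1) \<kappa>[OF f] by (auto simp: le_Suc_eq)
    ultimately show ?thesis unfolding colourable_def by (intro exI[of _ ?c]) auto
  qed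
  let ?Q = "pair_pmf (P (all_pairs m)) (P star)"
  let ?h = "\<lambda>(f, g) e. if e \<in> all_pairs m then f e else g e"
  let ?bad = "{f. \<not> colourable (Suc m) k {e. f e}}"
  \<comment> \<open>Off its index set a sample takes the default value \<open>False\<close>. Without
    this, \<open>g\<close> could contribute edges outside \<open>star\<close> to the glued graph, so
    the inclusion of events below holds only almost surely.\<close>
  have supp: "set_pmf (P A) \<subseteq> {f. \<forall>e. e \<notin> A \<longrightarrow> \<not> f e}" if "finite A" for A
    using set_Pi_pmf_subset[OF that] unfolding P_def by fastforce
  have "P (all_pairs (Suc m)) = map_pmf ?h ?Q"
    unfolding split P_def by (rule Pi_pmf_union[OF finite_all_pairs fin disj])
  then have "measure_pmf.prob (P (all_pairs (Suc m))) ?bad = measure_pmf.prob ?Q (?h -` ?bad)"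
    by simp
  also have "\<dots> \<le> measure_pmf.prob ?Q ({(f, g). \<not> col f \<and> True} \<union> {(f, g). col f \<and> R f g})"
  proof (rule measure_pmf.finite_measure_mono_AE)
    show "AE x in measure_pmf ?Q. x \<in> ?h -` ?bad \<longrightarrow> x \<in> {(f, g). \<not> col f \<and> True} \<union> {(f, g). col f \<and> R f g}"
      unfolding AE_measure_pmf_iff
    proof (intro ballI impI)
      fix x assume x: "x \<in> set_pmf ?Q" "x \<in> ?h -` ?bad"
      obtain f g where fg: "x = (f, g)" by (cases x)
      have "\<forall>e. e \<notin> all_pairs m \<longrightarrow> \<not> f e" "\<forall>e. e \<notin> star \<longrightarrow> \<not> g e"
        using x(1) supp[OF finite_all_pairs] supp[OF fin] by (auto simp: fg)
      from extend[OF _ _ this] x(2) show "x \<in> {(f, g). \<not> col f \<and> True} \<union> {(f, g). col f \<and> R f g}"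
        by (auto simp: fg)
    qed
  qed simp
  also have "\<dots> \<le> measure_pmf.prob ?Q {(f, g). \<not> col f \<and> True} + measure_pmf.prob ?Q {(f, g). col f \<and> R f g}"
    by (rule measure_Un_le) auto
  \<comment> \<open>The trivial conjunct \<open>True\<close> makes the first event an instance of
    \<open>prob_pair_pmf_le\<close> with bound 1.\<close>
  also have "\<dots> \<le> measure_pmf.prob (P (all_pairs m)) {f. \<not> col f} * 1 + measure_pmf.prob (P (all_pairs m)) {f. col f} * \<delta>"
    by (intro add_mono prob_pair_pmf_le step) (auto simp: \<delta>_def)
  also have "\<dots> \<le> m * \<delta> + 1 * \<delta>"
    using Suc by (intro add_mono mult_right_mono) (auto simp: \<delta>_def P_def col_def)
  finally show ?case by (simp add: P_def \<delta>_def algebra_simps)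
qed

lemma prob_gnp_not_colourable_le:
  fixes p :: real
  assumes "0 \<le> p" "p < 1" "0 < k"
  shows "measure_pmf.prob (gnp n p) {E. \<not> colourable n k E} \<le> n * exp (- (k * exp (real n / k * ln (1 - p))))"
  using prob_not_colourable_le[OF assms order_refl, of n] unfolding gnp_def by simp

section \<open>The dimension of a random graph\<close>

text \<open>Supports consist of ordered pairs, and that of the sphere matrix contains the whole
  diagonal, which says nothing about edges; hence the condition \<open>i \<noteq> j\<close>.\<close>

definition avoiding :: "(nat \<times> nat) set \<Rightarrow> nat set set set" where
  "avoiding Z = {E. \<forall>(i, j)\<in>Z. i \<noteq> j \<longrightarrow> {i, j} \<notin> E}"

text \<open>The form \<open>|u\<^sub>i - u\<^sub>j|\<^sup>2 - (r\<^sub>i + r\<^sub>j)\<^sup>2\<close> is symmetric, nonzero for \<open>i = j\<close>, and its rows are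
  combinations of the coordinate functions, the radius, a constant and \<open>|u\<^sub>j|\<^sup>2 - r\<^sub>j\<^sup>2\<close>.\<close>

lemma touching_spheres_patterns:
  assumes t: "touching_spheres n E d" and n: "0 < n"
  obtains U I S Z where "U \<subseteq> {1..n}" "U \<noteq> {}" "I \<subseteq> U" "S \<subseteq> I \<times> U" "Z \<in> patterns U I S"
    "card I * n \<le> (d + 3) * card U" "card S * card U \<le> card I * card Z"
    "card U * card U \<le> card I * card Z" "E \<in> avoiding Z"
proof -
  obtain u r where r: "\<And>i. i \<in> {1..n} \<Longrightarrow> r i > 0" and
    ur: "\<And>i j. i \<in> {1..n} \<Longrightarrow> j \<in> {1..n} \<Longrightarrow> {i, j} \<in> E \<Longrightarrow> dist_d d (u i) (u j) = r i + r j"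
    using t unfolding touching_spheres_def by blast
  define M where "M i j = (\<Sum>k<d. (u i k - u j k)\<^sup>2) - (r i + r j)\<^sup>2" for i j
  define g where "g k j = (if k < d then u j k else if k = d then r j else if k = Suc d then 1
      else (\<Sum>k<d. (u j k)\<^sup>2) - (r j)\<^sup>2)" for k j
  have sym: "M i j = M j i" for i j
    by (simp add: M_def add.commute power2_commute)
  have diag: "M i i \<noteq> 0" if "i \<in> {1..n}" for i using r[OF that] by (simp add: M_def)
  have gen: "\<exists>c. \<forall>l\<in>{1..n}. M i l = (\<Sum>k\<in>{..<d + 3}. c k * g k l)" for i
  proof (intro exI ballI)
    fix l
    define c where "c k = (if k < d then - 2 * u i k else if k = d then - 2 * r i
      else if k = Suc d then (\<Sum>k<d. (u i k)\<^sup>2) - (r i)\<^sup>2 else 1)" for k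
    have "(\<Sum>k\<in>{..<d + 3}. c k * g k l) = (\<Sum>k<d. c k * g k l) + c d * g d l
        + c (Suc d) * g (Suc d) l + c (Suc (Suc d)) * g (Suc (Suc d)) l"
      by (simp add: numeral_3_eq_3)
    also have "(\<Sum>k<d. c k * g k l) = (\<Sum>k<d. - 2 * u i k * u l k)"
      by (intro sum.cong) (auto simp: c_def g_def)
    also have "\<dots> + c d * g d l + c (Suc d) * g (Suc d) l + c (Suc (Suc d)) * g (Suc (Suc d)) l = M i l"
      by (simp add: c_def g_def M_def power2_diff power2_sum sum.distrib sum_subtractf
        sum_negf algebra_simps)
    finally show "M i l = (\<Sum>k\<in>{..<d + 3}. c k * g k l)" ..
  qed
  obtain U I where UI: "U \<subseteq> {1..n}" "U \<noteq> {}" "I \<subseteq> U" "row_indep M U I"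
    "\<forall>j\<in>U. in_row_span M U I j" "card I * card {1..n} \<le> card {..<d + 3} * card U"
    "card (supp M I U) * card U \<le> card I * card (supp M U U)"
    "card U * card U \<le> card I * card (supp M U U)"
    using sparse_row_basis[of "{1..n}" "{..<d + 3}" M g] n sym diag gen by auto
  have "E \<in> avoiding (supp M U U)"
  proof -
    have "M i j = 0" if "i \<in> U" "j \<in> U" "{i, j} \<in> E" for i j
    proof -
      have "sqrt (\<Sum>k<d. (u i k - u j k)\<^sup>2) = r i + r j"
        using ur[OF subsetD[OF UI(1) that(1)] subsetD[OF UI(1) that(2)] that(3)]
        by (simp add: dist_d_def)
      moreover have "(sqrt (\<Sum>k<d. (u i k - u j k)\<^sup>2))\<^sup>2 = (\<Sum>k<d. (u i k - u j k)\<^sup>2)"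
        by (intro real_sqrt_pow2 sum_nonneg) simp
      ultimately show ?thesis by (simp add: M_def)
    qed
    then show ?thesis by (auto simp: avoiding_def supp_def)
  qed
  moreover have "supp M I U \<subseteq> I \<times> U" by (auto simp: supp_def)
  moreover have "supp M U U \<in> patterns U I (supp M I U)"
    unfolding patterns_def using UI sym by blast
  ultimately show thesis using UI that[of U I "supp M I U" "supp M U U"] by simp
qed

text \<open>The diagonal accounts for at most \<open>card U\<close>, hence at most half, of the
  pairs in \<open>Z\<close>, and each edge for at most two of them. So at least
  \<open>card Z / 4\<close> distinct edges must be absent.\<close>

lemma prob_avoiding_le:
  assumes p: "0 \<le> p" "p < 1" and U: "U \<subseteq> {1..n}" and Z: "Z \<subseteq> U \<times> U" and dense: "2 * card U \<le> card Z"
  shows "measure_pmf.prob (gnp n p) (avoiding Z) \<le> exp (- (ln (1 / (1 - p)) * card Z / 4))"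
proof -
  define Z' where "Z' = {(i, j)\<in>Z. i \<noteq> j}"
  define F where "F = (\<lambda>(i, j). {i, j}) ` Z'"
  have fU: "finite U" using U finite_subset by blast
  have fZ: "finite Z" using Z fU finite_subset by blast
  have fZ': "finite Z'" by (rule finite_subset[OF _ fZ]) (auto simp: Z'_def)
  have fF: "finite F" unfolding F_def using fZ' by simp
  have FA: "F \<subseteq> all_pairs n"
  proof
    fix e assume "e \<in> F"
    then obtain i j where "(i, j) \<in> Z" "i \<noteq> j" "e = {i, j}" by (auto simp: F_def Z'_def)
    then show "e \<in> all_pairs n" using Z U unfolding all_pairs_def by blast
  qed
  have "card Z \<le> card U + 2 * card F"
  proof -
    have fib: "card {z \<in> Z'. (\<lambda>(i, j). {i, j}) z = e} \<le> 2" if e: "e \<in> F" for e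
    proof -
      obtain i j where ij: "e = {i, j}" using e by (auto simp: F_def)
      have "{z \<in> Z'. (\<lambda>(i, j). {i, j}) z = e} \<subseteq> {(i, j), (j, i)}"
      proof
        fix z assume "z \<in> {z \<in> Z'. (\<lambda>(i, j). {i, j}) z = e}"
        then have "{fst z, snd z} = {i, j}" by (simp add: ij case_prod_beta)
        then show "z \<in> {(i, j), (j, i)}"
          unfolding doubleton_eq_iff by (cases z) simp
      qed
      then have "card {z \<in> Z'. (\<lambda>(i, j). {i, j}) z = e} \<le> card {(i, j), (j, i)}"
        by (intro card_mono) auto
      also have "\<dots> \<le> 2" using card_length[of "[(i, j), (j, i)]"] by simp
      finally show ?thesis .
    qed
    have "Z' = (\<Union>e\<in>F. {z \<in> Z'. (\<lambda>(i, j). {i, j}) z = e})" by (auto simp: F_def)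
    then have "card Z' \<le> (\<Sum>e\<in>F. card {z \<in> Z'. (\<lambda>(i, j). {i, j}) z = e})"
      using card_UN_le[OF fF, of "\<lambda>e. {z \<in> Z'. (\<lambda>(i, j). {i, j}) z = e}"] by simp
    also have "\<dots> \<le> (\<Sum>e\<in>F. 2)" by (intro sum_mono fib)
    finally have "card Z' \<le> 2 * card F" by simp
    moreover have "Z \<subseteq> (\<lambda>i. (i, i)) ` U \<union> Z'" using Z by (auto simp: Z'_def)
    then have "card Z \<le> card ((\<lambda>i. (i, i)) ` U \<union> Z')"
      using fU fZ' by (intro card_mono) auto
    moreover have "card ((\<lambda>i. (i, i)) ` U \<union> Z') \<le> card U + card Z'"
      using card_Un_le[of "(\<lambda>i. (i, i)) ` U" Z'] card_image_le[OF fU, of "\<lambda>i. (i, i)"] by linarith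
    ultimately show ?thesis by linarith
  qed
  with dense have F4: "card Z \<le> 4 * card F" by linarith
  have "avoiding Z = {E. \<forall>e\<in>F. e \<notin> E}" by (auto simp: avoiding_def F_def Z'_def)
  then have "measure_pmf.prob (gnp n p) (avoiding Z) = (1 - p) ^ card F"
    using prob_Pi_bernoulli_none[OF finite_all_pairs FA p(1)] p(2) by (simp add: gnp_def)
  also have "\<dots> = exp (card F * ln (1 - p))" using p(2) by (simp add: exp_of_nat_mult)
  also have "\<dots> \<le> exp (- (ln (1 / (1 - p)) * card Z / 4))"
  proof -
    have "ln (1 - p) \<le> 0" using p by simp
    moreover have "real (card Z) / 4 \<le> card F" using F4 by linarith
    ultimately have "card F * ln (1 - p) \<le> real (card Z) / 4 * ln (1 - p)"
      by (intro mult_right_mono_neg)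
    then show ?thesis using p by (simp add: ln_div mult.commute)
  qed
  finally show ?thesis .
qed

section \<open>Union bound excluding small dimensions\<close>

lemma sum_Pow_power_card:
  fixes x :: "'a :: comm_semiring_1"
  assumes "finite A"
  shows "(\<Sum>X\<in>Pow A. x ^ card X) = (1 + x) ^ card A"
proof -
  have "(1 + x) ^ card A = (\<Prod>a\<in>A. x + 1)" by (simp add: add.commute)
  also have "\<dots> = (\<Sum>X\<in>Pow A. (\<Prod>a\<in>X. x) * (\<Prod>a\<in>A - X. 1))" by (rule prod_add[OF assms])
  also have "\<dots> = (\<Sum>X\<in>Pow A. x ^ card X)" by simp
  finally show ?thesis ..
qed

text \<open>With \<open>s = card S\<close> and \<open>u = card U\<close>, each \<open>Z\<close> is
  avoided with probability at most \<open>n^(-8(s+u))\<close>, and there are at most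
  \<open>n^(5s)\<close> of them. Summing the remaining \<open>n^(-3s) * n^(-8u)\<close> over
  \<open>S\<close> gives the factor with exponent \<open>n\<^sup>2\<close>, over \<open>I\<close> a
  factor \<open>2^u\<close>, and over nonempty \<open>U\<close> the first factor.\<close>

lemma prob_touching_spheres_le:
  fixes p :: real
  assumes p: "0 < p" "p \<le> 1 - 1 / n" and n: "2 \<le> n"
  shows "measure_pmf.prob (gnp n p)
      {E. \<exists>d. real (d + 3) * ln n \<le> n * ln (1 / (1 - p)) / 64 \<and> touching_spheres n E d}
    \<le> ((1 + 2 / real n ^ 8) ^ n - 1) * (1 + 1 / real n ^ 3) ^ n\<^sup>2"
proof -
  define L where "L = ln (1 / (1 - p))"
  define \<epsilon> where "\<epsilon> = 1 / real n ^ 8"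
  have p1: "p < 1" using p(2) n by (smt (verit) divide_pos_pos of_nat_0_less_iff zero_less_numeral less_le_trans)
  have lnn: "ln (real n) > 0" using n by simp
  have L0: "L > 0" using p p1 by (simp add: L_def ln_div)
  have Ln: "L \<le> ln n"
  proof -
    have "1 / n \<le> 1 - p" using p(2) by linarith
    then have "1 / (1 - p) \<le> n" using n p1 by (simp add: field_simps)
    then show ?thesis unfolding L_def using p1 n by simp
  qed
  \<comment> \<open>The constant 32 is twice the quarter-free rate needed: the assumed 1/64 bounds
    the shares of \<open>card S\<close> and \<open>card U\<close> separately, and their sum doubles
    it. Dividing by the 4 of \<open>prob_avoiding_le\<close> leaves the exponent 8 in
    \<open>\<epsilon>\<close>.\<close>
  define G where "G U I S = {Z\<in>patterns U I S. 2 * card U \<le> card Z \<and>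
      32 * (real (card S + card U) * ln n) \<le> L * card Z}" for U I S
  let ?P = "measure_pmf.prob (gnp n p)"
  have patZ: "Z \<subseteq> U \<times> U" if "Z \<in> patterns U I S" for Z U I S
    using that by (auto simp: patterns_def supp_def)
  have finU: "finite U" if "U \<subseteq> {1..n}" for U using that finite_subset by blast
  have finp: "finite (patterns U I S)" if "U \<subseteq> {1..n}" for U I S
  proof (rule finite_subset)
    show "patterns U I S \<subseteq> Pow (U \<times> U)" using patZ by blast
    show "finite (Pow (U \<times> U))" using finU[OF that] by simp
  qed
  have sub: "{E. \<exists>d. real (d + 3) * ln n \<le> n * ln (1 / (1 - p)) / 64 \<and> touching_spheres n E d} \<subseteq>
    (\<Union>U\<in>Pow {1..n} - {{}}. \<Union>I\<in>Pow U. \<Union>S\<in>Pow (I \<times> U). \<Union>Z\<in>G U I S. avoiding Z)"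
  proof
    fix E assume "E \<in> {E. \<exists>d. real (d + 3) * ln n \<le> n * ln (1 / (1 - p)) / 64 \<and> touching_spheres n E d}"
    then obtain d where d: "real (d + 3) * ln n \<le> n * L / 64" "touching_spheres n E d"
      by (auto simp: L_def)
    obtain U I S Z where Z: "U \<subseteq> {1..n}" "U \<noteq> {}" "I \<subseteq> U" "S \<subseteq> I \<times> U" "Z \<in> patterns U I S"
      "card I * n \<le> (d + 3) * card U" "card S * card U \<le> card I * card Z"
      "card U * card U \<le> card I * card Z" "E \<in> avoiding Z"
      by (rule touching_spheres_patterns[OF d(2)]) (use n in auto)
    have cU: "real (card U) > 0" using Z(2) finU[OF Z(1)] by (simp add: card_gt_0_iff)
    have "real (card I) * n \<le> real (d + 3) * card U" using Z(6) by (metis of_nat_le_iff of_nat_mult)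
    then have "real (card I) * n * ln n \<le> real (d + 3) * card U * ln n"
      using lnn by (intro mult_right_mono) auto
    also have "\<dots> = (real (d + 3) * ln n) * card U" by simp
    also have "\<dots> \<le> (n * L / 64) * card U" using d(1) by (intro mult_right_mono) auto
    finally have I: "64 * (real (card I) * ln n) \<le> L * card U"
      using n by (simp add: field_simps)
    \<comment> \<open>Used for \<open>x = card S\<close> (sparsity of the basis) and for
      \<open>x = card U\<close> (density of the support).\<close>
    have key: "64 * (real x * ln n) \<le> L * card Z" if x: "x * card U \<le> card I * card Z" for x
    proof -
      have "real x * card U \<le> real (card I) * card Z" using x by (metis of_nat_le_iff of_nat_mult)
      then have "64 * ln n * (real x * card U) \<le> 64 * ln n * (real (card I) * card Z)"
        using lnn by (intro mult_left_mono) auto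
      also have "\<dots> = 64 * (real (card I) * ln n) * card Z" by simp
      also have "\<dots> \<le> L * card U * card Z" using I by (intro mult_right_mono) auto
      finally have "(64 * (real x * ln n)) * card U \<le> (L * card Z) * card U" by (simp add: mult_ac)
      then show ?thesis using cU by simp
    qed
    \<comment> \<open>Here \<open>p \<le> 1 - 1 / n\<close> enters: \<open>L \<le> ln n\<close>
      turns the bound into \<open>64 * card U \<le> card Z\<close>, so the diagonal is a negligible
      part of \<open>Z\<close>.\<close>
    have "64 * (real (card U) * ln n) \<le> ln n * card Z"
      using key[OF Z(8)] mult_right_mono[OF Ln, of "card Z"] by linarith
    then have "ln n * (64 * real (card U)) \<le> ln n * card Z" by (simp add: mult_ac)
    then have "64 * real (card U) \<le> card Z" using lnn by simp
    then have "2 * card U \<le> card Z" by linarith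
    moreover have "32 * (real (card S + card U) * ln n) \<le> L * card Z"
      using key[OF Z(7)] key[OF Z(8)] by (simp add: distrib_right distrib_left)
    ultimately have "Z \<in> G U I S" using Z(5) by (simp add: G_def)
    with Z show "E \<in> (\<Union>U\<in>Pow {1..n} - {{}}. \<Union>I\<in>Pow U. \<Union>S\<in>Pow (I \<times> U). \<Union>Z\<in>G U I S. avoiding Z)"
      by blast
  qed
  have eps: "\<epsilon> > 0" using n by (simp add: \<epsilon>_def)
  have avoid: "?P (avoiding Z) \<le> \<epsilon> ^ card S * \<epsilon> ^ card U" if U: "U \<subseteq> {1..n}" and Z: "Z \<in> G U I S" for U I S Z
  proof -
    have "?P (avoiding Z) \<le> exp (- (L * card Z / 4))"
      unfolding L_def using Z p p1 by (intro prob_avoiding_le[OF _ _ U patZ]) (auto simp: G_def)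
    also have "\<dots> \<le> exp (- (8 * real (card S + card U) * ln n))"
    proof -
      have "32 * (real (card S + card U) * ln n) \<le> L * card Z" using Z by (simp add: G_def)
      then have "8 * real (card S + card U) * ln n \<le> L * card Z / 4" by linarith
      then show ?thesis by (simp only: exp_le_cancel_iff neg_le_iff_le)
    qed
    also have "\<dots> = \<epsilon> ^ (card S + card U)"
    proof -
      have "exp (- (8 * real (card S + card U) * ln n)) = exp (real (card S + card U) * (- (real 8 * ln n)))"
        by (simp add: mult_ac)
      also have "\<dots> = exp (- (real 8 * ln n)) ^ (card S + card U)" by (rule exp_of_nat_mult)
      also have "exp (- (real 8 * ln n)) = \<epsilon>"
        using n by (simp add: \<epsilon>_def exp_minus exp_of_nat_mult[of 8 "ln n", simplified] inverse_eq_divide)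
      finally show ?thesis .
    qed
    finally show ?thesis by (simp add: power_add)
  qed
  have S: "?P (\<Union>Z\<in>G U I S. avoiding Z) \<le> (1 / real n ^ 3) ^ card S * \<epsilon> ^ card U"
    if U: "U \<subseteq> {1..n}" and I: "I \<subseteq> U" and S: "S \<subseteq> I \<times> U" for U I S
  proof -
    have cU: "card U \<le> n" using card_mono[OF _ U] by simp
    have cI: "card I \<le> n" using card_mono[OF finU[OF U] I] cU by simp
    have fG: "finite (G U I S)" unfolding G_def using finp[OF U] by simp
    have "card U * card U * (card I + 1) + 1 \<le> n * n * (n + 1) + 1"
      using cU cI by (intro add_mono mult_mono) auto
    also have "\<dots> \<le> n ^ 5"
    proof -
      have "2 * 2 \<le> n * n" using n by (intro mult_mono) auto
      then have "n * n * (n + 1) + 1 \<le> n * n * (n + 1) + n * n" by linarith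
      also have "\<dots> = n * n * (n + 2)" by (simp add: algebra_simps)
      also have "\<dots> \<le> n * n * (n * n * n)"
      proof (intro mult_left_mono)
        have "n + 2 \<le> 2 * n" using n by simp
        also have "\<dots> \<le> n * n * n" using n \<open>2 * 2 \<le> n * n\<close> by (intro mult_right_mono) auto
        finally show "n + 2 \<le> n * n * n" .
      qed auto
      finally show ?thesis by (simp add: eval_nat_numeral)
    qed
    finally have bas: "card U * card U * (card I + 1) + 1 \<le> n ^ 5" .
    have "card (G U I S) \<le> card (patterns U I S)"
      unfolding G_def using finp[OF U] by (intro card_mono) auto
    also have "\<dots> \<le> (card U * card U * (card I + 1) + 1) ^ card S"
      by (rule card_patterns[OF finU[OF U] I S])
    also have "\<dots> \<le> (n ^ 5) ^ card S" by (rule power_mono[OF bas]) simp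
    finally have "real (card (G U I S)) \<le> real ((n ^ 5) ^ card S)" by (rule of_nat_mono)
    then have cG: "real (card (G U I S)) \<le> (real n ^ 5) ^ card S" by simp
    have "?P (\<Union>Z\<in>G U I S. avoiding Z) \<le> (\<Sum>Z\<in>G U I S. ?P (avoiding Z))"
      by (rule measure_UNION_le[OF fG]) simp
    also have "\<dots> \<le> (\<Sum>Z\<in>G U I S. \<epsilon> ^ card S * \<epsilon> ^ card U)"
      by (intro sum_mono avoid[OF U])
    also have "\<dots> = card (G U I S) * (\<epsilon> ^ card S * \<epsilon> ^ card U)" by simp
    also have "\<dots> \<le> (real n ^ 5) ^ card S * (\<epsilon> ^ card S * \<epsilon> ^ card U)"
      using cG eps by (intro mult_right_mono) auto
    also have "\<dots> = (real n ^ 5 * \<epsilon>) ^ card S * \<epsilon> ^ card U"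
      by (simp add: power_mult_distrib)
    also have "real n ^ 5 * \<epsilon> = 1 / real n ^ 3"
      using n by (simp add: \<epsilon>_def field_simps power_add[symmetric])
    finally show ?thesis .
  qed
  have I: "?P (\<Union>S\<in>Pow (I \<times> U). \<Union>Z\<in>G U I S. avoiding Z) \<le> (1 + 1 / real n ^ 3) ^ n\<^sup>2 * \<epsilon> ^ card U"
    if U: "U \<subseteq> {1..n}" and I: "I \<subseteq> U" for U I
  proof -
    have fin: "finite (I \<times> U)" using finU[OF U] I finite_subset by blast
    have "?P (\<Union>S\<in>Pow (I \<times> U). \<Union>Z\<in>G U I S. avoiding Z) \<le>
        (\<Sum>S\<in>Pow (I \<times> U). ?P (\<Union>Z\<in>G U I S. avoiding Z))"
      by (rule measure_UNION_le) (use fin in auto)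
    also have "\<dots> \<le> (\<Sum>S\<in>Pow (I \<times> U). (1 / real n ^ 3) ^ card S * \<epsilon> ^ card U)"
      by (intro sum_mono S[OF U I]) auto
    also have "\<dots> = (1 + 1 / real n ^ 3) ^ card (I \<times> U) * \<epsilon> ^ card U"
      using sum_Pow_power_card[OF fin, of "1 / real n ^ 3"] by (simp only: sum_distrib_right[symmetric])
    also have "\<dots> \<le> (1 + 1 / real n ^ 3) ^ n\<^sup>2 * \<epsilon> ^ card U"
    proof (intro mult_right_mono power_increasing)
      have "card (I \<times> U) \<le> card ({1..n} \<times> {1..n})" using U I by (intro card_mono) auto
      then show "card (I \<times> U) \<le> n\<^sup>2" by (simp add: card_cartesian_product power2_eq_square)
    qed (use eps in auto)
    finally show ?thesis .
  qed
  have U: "?P (\<Union>I\<in>Pow U. \<Union>S\<in>Pow (I \<times> U). \<Union>Z\<in>G U I S. avoiding Z) \<le>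
      (1 + 1 / real n ^ 3) ^ n\<^sup>2 * (2 * \<epsilon>) ^ card U"
    if U: "U \<subseteq> {1..n}" for U
  proof -
    have "?P (\<Union>I\<in>Pow U. \<Union>S\<in>Pow (I \<times> U). \<Union>Z\<in>G U I S. avoiding Z) \<le>
      (\<Sum>I\<in>Pow U. ?P (\<Union>S\<in>Pow (I \<times> U). \<Union>Z\<in>G U I S. avoiding Z))"
      by (rule measure_UNION_le) (use finU[OF U] in auto)
    also have "\<dots> \<le> (\<Sum>I\<in>Pow U. (1 + 1 / real n ^ 3) ^ n\<^sup>2 * \<epsilon> ^ card U)"
      by (intro sum_mono I[OF U]) auto
    also have "\<dots> = (1 + 1 / real n ^ 3) ^ n\<^sup>2 * (2 * \<epsilon>) ^ card U"
      using finU[OF U] by (simp add: card_Pow power_mult_distrib)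
    finally show ?thesis .
  qed
  have "?P {E. \<exists>d. real (d + 3) * ln n \<le> n * ln (1 / (1 - p)) / 64 \<and> touching_spheres n E d} \<le>
      ?P (\<Union>U\<in>Pow {1..n} - {{}}. \<Union>I\<in>Pow U. \<Union>S\<in>Pow (I \<times> U). \<Union>Z\<in>G U I S. avoiding Z)"
    by (rule measure_pmf.finite_measure_mono[OF sub]) simp
  also have "\<dots> \<le> (\<Sum>U\<in>Pow {1..n} - {{}}. ?P (\<Union>I\<in>Pow U. \<Union>S\<in>Pow (I \<times> U). \<Union>Z\<in>G U I S. avoiding Z))"
    by (rule measure_UNION_le) auto
  also have "\<dots> \<le> (\<Sum>U\<in>Pow {1..n} - {{}}. (1 + 1 / real n ^ 3) ^ n\<^sup>2 * (2 * \<epsilon>) ^ card U)"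
    by (intro sum_mono U) auto
  also have "\<dots> = (1 + 1 / real n ^ 3) ^ n\<^sup>2 * (\<Sum>U\<in>Pow {1..n} - {{}}. (2 * \<epsilon>) ^ card U)"
    by (simp add: sum_distrib_left)
  \<comment> \<open>Leaving out the empty \<open>U\<close> produces the \<open>- 1\<close>, without
    which the bound would not tend to 0.\<close>
  also have "(\<Sum>U\<in>Pow {1..n} - {{}}. (2 * \<epsilon>) ^ card U) = (\<Sum>U\<in>Pow {1..n}. (2 * \<epsilon>) ^ card U) - 1"
    by (subst sum_diff1) auto
  also have "(\<Sum>U\<in>Pow {1..n}. (2 * \<epsilon>) ^ card U) = (1 + 2 / real n ^ 8) ^ n"
    by (subst sum_Pow_power_card) (simp_all add: \<epsilon>_def)
  finally show ?thesis by (simp add: mult.commute)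
qed

section \<open>Both bounds combined\<close>

lemma prob_sphere_dim_bounds:
  fixes n :: nat and p X :: real
  defines "X \<equiv> n * ln (1 / (1 - p)) / ln n"
  assumes n: "2 \<le> n" and p: "real n powr (-0.99) \<le> p" "p \<le> 1 - 1 / n"
    and large: "384 \<le> real n powr 0.01 / ln n"
  shows "measure_pmf.prob (gnp n p) {E. 1 / 128 * X \<le> sphere_dim n E \<and> sphere_dim n E \<le> 400 * X}
    \<ge> 1 - (((1 + 2 / real n ^ 8) ^ n - 1) * (1 + 1 / real n ^ 3) ^ n\<^sup>2
           + n * exp (- (200 * (real n powr 0.005 / ln n))))"
proof -
  let ?P = "measure_pmf.prob (gnp n p)"
  let ?good = "{E. 1 / 128 * X \<le> sphere_dim n E \<and> sphere_dim n E \<le> 400 * X}"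
  define L where "L = ln (1 / (1 - p))"
  define k where "k = nat \<lfloor>400 * X\<rfloor>"
  have lnn: "ln (real n) > 0" using n by simp
  have "0 < real n powr (-0.99)" using n by simp
  then have p0: "0 < p" using p(1) by linarith
  have "0 < 1 / real n" using n by simp
  then have p1: "p < 1" using p(2) by linarith
  have L: "L = - ln (1 - p)" using p1 by (simp add: L_def ln_div)
  have "p \<le> L" using ln_le_minus_one[of "1 - p"] p1 by (simp add: L)
  have L0: "0 < L" using \<open>p \<le> L\<close> p0 by linarith
  \<comment> \<open>This is where the lower bound on \<open>p\<close> enters: \<open>n * p\<close>,
    and hence \<open>n * L\<close>, is at least \<open>n^0.01\<close>.\<close>
  have "real n powr 0.01 = n * real n powr (-0.99)"
    using n powr_add[of "real n" 1 "-0.99"] by simp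
  also have "\<dots> \<le> n * L" using p(1) \<open>p \<le> L\<close> by (intro mult_left_mono) auto
  finally have X1: "real n powr 0.01 / ln n \<le> X"
    unfolding X_def L_def[symmetric] using lnn by (intro divide_right_mono) auto
  then have X: "384 \<le> X" using large by linarith
  have k: "k \<le> 400 * X" "200 * X \<le> k" using X unfolding k_def by linarith+
  have k0: "0 < real k" using k X by linarith
  \<comment> \<open>Since \<open>k \<ge> 200 * X\<close>, the factor \<open>(1 - p)^(n/k)\<close> is
    at least \<open>n^(-1/200)\<close>. This takes only 0.005 from the exponent 0.01 in the lower
    bound for \<open>X\<close>, so a positive power of \<open>n\<close> is left.\<close>
  have "200 * (real n powr 0.005 / ln n) \<le> k * exp (real n / k * ln (1 - p))"
  proof -
    have "- (ln n / 200) \<le> real n / k * ln (1 - p)"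
    proof -
      have "real n / k * L \<le> real n / (200 * X) * L"
        using k X L0 by (intro mult_right_mono divide_left_mono) auto
      also have "\<dots> = ln n / 200"
        using L0 lnn n unfolding X_def L_def[symmetric] by (simp add: field_simps)
      finally show ?thesis by (simp add: L)
    qed
    then have "exp (- (ln n / 200)) \<le> exp (real n / k * ln (1 - p))" by simp
    moreover have "real n powr 0.005 / ln n = (real n powr 0.01 / ln n) * exp (- (ln n / 200))"
      using n by (simp add: powr_def exp_add[symmetric])
    moreover have "(real n powr 0.01 / ln n) * exp (- (ln n / 200)) \<le> X * exp (- (ln n / 200))"
      using X1 by (intro mult_right_mono) auto
    moreover have "(200 * X) * exp (- (ln n / 200)) \<le> k * exp (real n / k * ln (1 - p))"
      using calculation(1) k X by (intro mult_mono) auto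
    ultimately show ?thesis by linarith
  qed
  then have "n * exp (- (k * exp (real n / k * ln (1 - p)))) \<le> n * exp (- (200 * (real n powr 0.005 / ln n)))"
    by (intro mult_left_mono) auto
  with prob_gnp_not_colourable_le[of p k n] p0 p1 k0
  have upper: "?P {E. \<not> colourable n k E} \<le> n * exp (- (200 * (real n powr 0.005 / ln n)))" by simp
  let ?low = "{E. \<exists>d. real (d + 3) * ln n \<le> n * ln (1 / (1 - p)) / 64 \<and> touching_spheres n E d}"
  have "UNIV - ?good \<subseteq> ?low \<union> {E. \<not> colourable n k E}"
  proof
    fix E assume E: "E \<in> UNIV - ?good"
    show "E \<in> ?low \<union> {E. \<not> colourable n k E}"
    proof (cases "colourable n k E")
      case True
      \<comment> \<open>Colourability also guarantees that the \<open>LEAST\<close> in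
        \<open>sphere_dim\<close> is attained.\<close>
      then have t: "touching_spheres n E k" by (rule touching_spheres_if_colourable)
      have dk: "sphere_dim n E \<le> k" unfolding sphere_dim_def using t by (rule Least_le)
      have td: "touching_spheres n E (sphere_dim n E)" unfolding sphere_dim_def using t by (rule LeastI)
      have "real (sphere_dim n E) \<le> 400 * X" using dk k(1) by linarith
      with E have "real (sphere_dim n E) < 1 / 128 * X" by auto
      \<comment> \<open>The threshold 384 is 3 * 128: it makes the additive 3 at most
        \<open>X / 128\<close>.\<close>
      then have "real (sphere_dim n E + 3) \<le> X / 64" using X by simp
      then have "real (sphere_dim n E + 3) * ln n \<le> X / 64 * ln n"
        using lnn by (intro mult_right_mono) auto
      also have "\<dots> = n * ln (1 / (1 - p)) / 64" using lnn by (simp add: X_def)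
      finally show ?thesis using td by blast
    qed simp
  qed
  then have "?P (UNIV - ?good) \<le> ?P (?low \<union> {E. \<not> colourable n k E})"
    by (intro measure_pmf.finite_measure_mono) auto
  also have "\<dots> \<le> ?P ?low + ?P {E. \<not> colourable n k E}" by (rule measure_Un_le) auto
  also have "\<dots> \<le> ((1 + 2 / real n ^ 8) ^ n - 1) * (1 + 1 / real n ^ 3) ^ n\<^sup>2
      + n * exp (- (200 * (real n powr 0.005 / ln n)))"
    by (intro add_mono upper prob_touching_spheres_le p0 p(2) n)
  finally show ?thesis
    using measure_pmf.prob_compl[of ?good "gnp n p"] by simp
qed

theorem theorem4p3:
  "\<exists>c C :: real. 0 < c \<and> c < C \<and>
     (\<forall>p :: nat \<Rightarrow> real.
        (\<forall>\<^sub>F n in sequentially. real n powr (-0.99) \<le> p n \<and> p n \<le> 1 - 1 / real n) \<longrightarrow>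
        ((\<lambda>n. measure_pmf.prob (gnp n (p n))
            {E. c * (real n * ln (1 / (1 - p n)) / ln (real n)) \<le> real (sphere_dim n E) \<and>
                real (sphere_dim n E) \<le> C * (real n * ln (1 / (1 - p n)) / ln (real n))})
          \<longlonglongrightarrow> 1))"
proof (rule exI[of _ "1 / 128"], rule exI[of _ 400], intro conjI allI impI)
  fix p :: "nat \<Rightarrow> real"
  assume p: "\<forall>\<^sub>F n in sequentially. real n powr (-0.99) \<le> p n \<and> p n \<le> 1 - 1 / real n"
  let ?err = "\<lambda>n. ((1 + 2 / real n ^ 8) ^ n - 1) * (1 + 1 / real n ^ 3) ^ n\<^sup>2
           + n * exp (- (200 * (real n powr 0.005 / ln n)))"
  \<comment> \<open>The first factor is of order \<open>n^(-7)\<close>, the second tends to 1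
    because \<open>n^2 * n^(-3)\<close> tends to 0, and the exponential of a power of
    \<open>n\<close> over \<open>ln n\<close> beats the factor \<open>n\<close>. The bases are
    positive, so \<open>powr\<close> agrees with the natural powers in \<open>?err\<close>.\<close>
  have "(\<lambda>n. ((1 + 2 / real n ^ 8) powr n - 1) * (1 + 1 / real n ^ 3) powr (real n ^ 2)
           + n * exp (- (200 * (real n powr 0.005 / ln n)))) \<longlonglongrightarrow> 0"
    by real_asymp
  also have "(\<lambda>n. ((1 + 2 / real n ^ 8) powr n - 1) * (1 + 1 / real n ^ 3) powr (real n ^ 2)
           + n * exp (- (200 * (real n powr 0.005 / ln n)))) = ?err"
  proof
    fix n :: nat
    have "0 < 1 + 2 / real n ^ 8" "0 < 1 + 1 / real n ^ 3" by (simp_all add: add_pos_nonneg)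
    then show "((1 + 2 / real n ^ 8) powr n - 1) * (1 + 1 / real n ^ 3) powr (real n ^ 2)
           + n * exp (- (200 * (real n powr 0.005 / ln n))) = ?err n"
      by (simp add: powr_realpow flip: of_nat_power)
  qed
  finally have err: "(\<lambda>n. 1 - ?err n) \<longlonglongrightarrow> 1"
    using tendsto_diff[OF tendsto_const[of 1]] by fastforce
  have "\<forall>\<^sub>F n :: nat in sequentially. 384 \<le> real n powr 0.01 / ln n"
    by real_asymp
  with p eventually_ge_at_top[of 2]
  have "\<forall>\<^sub>F n in sequentially. 1 - ?err n \<le> measure_pmf.prob (gnp n (p n))
            {E. 1 / 128 * (real n * ln (1 / (1 - p n)) / ln (real n)) \<le> real (sphere_dim n E) \<and>
                real (sphere_dim n E) \<le> 400 * (real n * ln (1 / (1 - p n)) / ln (real n))}"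
  proof eventually_elim
    case (elim n)
    then show ?case using prob_sphere_dim_bounds[of n "p n"] by blast
  qed
  then show "(\<lambda>n. measure_pmf.prob (gnp n (p n))
            {E. 1 / 128 * (real n * ln (1 / (1 - p n)) / ln (real n)) \<le> real (sphere_dim n E) \<and>
                real (sphere_dim n E) \<le> 400 * (real n * ln (1 / (1 - p n)) / ln (real n))}) \<longlonglongrightarrow> 1"
    by (intro tendsto_sandwich[OF _ _ err tendsto_const[of 1]]) auto
qed auto

end
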